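(* Let $\mathbf{d}=(d_1,\ldots,d_s)$ and $d^*=\max(d_1,\ldots,d_s)\ge 1$. Then $$ \mathcal{PI}_{\mathbf{d}}(z)=\sum_{i=0}^{d^*}\sum_{k=1}^{\beta_i}\frac{1}{(k-1)!}\,\frac{d^{k-1}}{dz^{k-1}}\Bigl(z^{k-1}\varphi_{d^*-i}\bigl((1-z^2)A_{i,k}(z)\bigr)\Bigr), $$ $$ \mathcal{PS}_{\mathbf{d}}(z)=\sum_{i=0}^{d^*}\sum_{k=1}^{\beta_i}\frac{1}{(k-1)!}\,\frac{d^{k-1}}{dz^{k-1}}\Bigl(z^{k-1}\varphi_{d^*-i}\bigl((1+z)A_{i,k}(z)\bigr)\Bigr). $$
   Context: Let $\mathbb{K}$ be a field of characteristic $0$ and $\mathbf{d}=(d_1,\ldots,d_s)$ a tuple of nonnegative integers ($s\ge 1$). Let $\mathbb{K}[X_{\mathbf{d}}]$ be the polynomial algebra in the variables $x_i^{(k)}$, $1\le k\le s$, $0\le i\le d_k$. Define $\mathbb{K}$-linear derivations of $\mathbb{K}[X_{\mathbf{d}}]$ by $$\mathcal{D}_{\mathbf{d}}(x_i^{(k)})=i\,x_{i-1}^{(k)},\qquad \mathcal{D}^*_{\mathbf{d}}(x_i^{(k)})=(d_k-i)\,x_{i+1}^{(k)}$$ (with $\mathcal{D}_{\mathbf{d}}(x_0^{(k)})=0$ and $\mathcal{D}^*_{\mathbf{d}}(x_{d_k}^{(k)})=0$). Put $\mathcal{I}_{\mathbf{d}}=\{v : \mathcal{D}_{\mathbf{d}}(v)=\mathcal{D}^*_{\mathbf{d}}(v)=0\}$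 and $\mathcal{S}_{\mathbf{d}}=\ker\mathcal{D}_{\mathbf{d}}=\{v : \mathcal{D}_{\mathbf{d}}(v)=0\}$, graded by total degree, with homogeneous components $(\cdot)_m$. Their Poincaré series are $$\mathcal{PI}_{\mathbf{d}}(z)=\sum_{m\ge0}\dim(\mathcal{I}_{\mathbf{d}})_m z^m,\qquad \mathcal{PS}_{\mathbf{d}}(z)=\sum_{m\ge0}\dim(\mathcal{S}_{\mathbf{d}})_m z^m.$$ Let $$f_{\mathbf{d}}(t,z)=\prod_{k=1}^{s}\prod_{j=0}^{d_k}\frac{1}{1-t z^{d_k-2j}}.$$ Then there are nonnegative integers $\beta_0,\ldots,\beta_{2d^*}$ such that $f_{\mathbf{d}}(tz^{d^*},z)=\prod_{i=0}^{2d^*}(1-tz^i)^{-\beta_i}$. The rational functions $A_{i,k}(z)$ are the coefficients of the partial fraction decomposition with respect to $t$, $$f_{\mathbf{d}}(tz^{d^*},z)=\sum_{i=0}^{2d^*}\sum_{k=1}^{\beta_i}\frac{A_{i,k}(z)}{(1-tz^i)^k},$$ i.e. $$A_{i,k}(z)=\frac{(-1)^{\beta_i-k}}{(\beta_i-k)!\,(z^i)^{\beta_i-k}}\lim_{t\to z^{-i}}\frac{\partial^{\beta_i-k}}{\partial t^{\beta_i-k}}\Bigl(f_{\mathbf{d}}(tz^{d^*},z)(1-tz^i)^{\beta_i}\Bigr).$$ They are regarded as power series by expansion at $z=0$. Sums over an empty range ($\beta_i=0$) are $0$. For an integer $n\ge 0$, $\varphi_n:\mathbb{C}[[z]]\to\mathbb{C}[[z]]$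 is the linear map $\varphi_n\bigl(\sum_{i\ge0}a_i z^i\bigr)=\sum_{i\ge0}a_{in}z^i$; in particular $\varphi_0\bigl(\sum_i a_i z^i\bigr)=a_0/(1-z)$. *)

theory Defs
  imports
    "HOL-Complex_Analysis.Complex_Analysis"
    "HOL-Library.Poly_Mapping"
begin

text \<open>Polynomials with coefficients in \<open>'k\<close> are finitely supported maps from monomials
  (finitely supported exponent maps) to \<open>'k\<close>. The pair \<open>(k, i)\<close> stands for the variable
  \<open>x_i^(k)\<close>; the components of the tuple \<open>d\<close> are numbered from 0, so \<open>k < length d\<close>.\<close>

type_synonym var = "nat \<times> nat"
type_synonym 'k mpol = "(var \<Rightarrow>\<^sub>0 nat) \<Rightarrow>\<^sub>0 'k"

definition Var :: "var \<Rightarrow> 'k::comm_ring_1 mpol" where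
  "Var v = Poly_Mapping.single (Poly_Mapping.single v 1) 1"

definition mscale :: "'k::comm_ring_1 \<Rightarrow> 'k mpol \<Rightarrow> 'k mpol" where
  "mscale c p = Poly_Mapping.single 0 c * p"

global_interpretation mpol: vector_space "mscale :: 'k::field \<Rightarrow> 'k mpol \<Rightarrow> 'k mpol"
proof
  fix a b :: 'k and p q :: "'k mpol"
  show "mscale a (p + q) = mscale a p + mscale a q"
    by (simp add: mscale_def distrib_left)
  show "mscale (a + b) p = mscale a p + mscale b p"
    by (simp add: mscale_def distrib_right single_add)
  show "mscale a (mscale b p) = mscale (a * b) p"
    by (simp add: mscale_def mult_single flip: mult.assoc)
  show "mscale 1 p = p"
    by (simp add: mscale_def)
qed

definition vars :: "nat list \<Rightarrow> var set" where
  "vars d = (SIGMA k:{..<length d}. {..d ! k})"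

definition poly_algebra :: "nat list \<Rightarrow> 'k::zero mpol set" where
  "poly_algebra d = {p. \<forall>m \<in> Poly_Mapping.keys p. Poly_Mapping.keys m \<subseteq> vars d}"

definition total_deg :: "(var \<Rightarrow>\<^sub>0 nat) \<Rightarrow> nat" where
  "total_deg m = (\<Sum>v \<in> Poly_Mapping.keys m. Poly_Mapping.lookup m v)"

definition homogeneous :: "nat \<Rightarrow> 'k::zero mpol set" where
  "homogeneous n = {p. \<forall>m \<in> Poly_Mapping.keys p. total_deg m = n}"

text \<open>Partial derivative with respect to \<open>v\<close>. If \<open>v\<close> does not occur in the monomial \<open>m\<close>, the
  truncated subtraction is harmless because the coefficient is 0.\<close>

definition pder :: "var \<Rightarrow> 'k::comm_ring_1 mpol \<Rightarrow> 'k mpol" where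
  "pder v p = (\<Sum>m \<in> Poly_Mapping.keys p.
     Poly_Mapping.single (m - Poly_Mapping.single v 1)
       (of_nat (Poly_Mapping.lookup m v) * Poly_Mapping.lookup p m))"

text \<open>The \<open>K\<close>-linear derivation sending each variable \<open>v \<in> V\<close> to \<open>g v\<close> (and every other
  variable to 0).\<close>

definition derivation :: "var set \<Rightarrow> (var \<Rightarrow> 'k::comm_ring_1 mpol) \<Rightarrow> 'k mpol \<Rightarrow> 'k mpol" where
  "derivation V g p = (\<Sum>v\<in>V. g v * pder v p)"

definition der_D :: "nat list \<Rightarrow> 'k::comm_ring_1 mpol \<Rightarrow> 'k mpol" where
  "der_D d = derivation (vars d) (\<lambda>(k, i). of_nat i * Var (k, i - 1))"

definition der_Dstar :: "nat list \<Rightarrow> 'k::comm_ring_1 mpol \<Rightarrow> 'k mpol" where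
  "der_Dstar d = derivation (vars d) (\<lambda>(k, i). of_nat (d ! k - i) * Var (k, i + 1))"

definition joint_invariants :: "nat list \<Rightarrow> 'k::comm_ring_1 mpol set" where
  "joint_invariants d = {p \<in> poly_algebra d. der_D d p = 0 \<and> der_Dstar d p = 0}"

definition joint_semi_invariants :: "nat list \<Rightarrow> 'k::comm_ring_1 mpol set" where
  "joint_semi_invariants d = {p \<in> poly_algebra d. der_D d p = 0}"

definition poincare_series :: "'k::field mpol set \<Rightarrow> complex fps" where
  "poincare_series W = Abs_fps (\<lambda>m. of_nat (mpol.dim (W \<inter> homogeneous m)))"

lemma pder_superset:
  assumes "finite S" "Poly_Mapping.keys p \<subseteq> S"
  shows "pder v p = (\<Sum>m \<in> S. Poly_Mapping.single (m - Poly_Mapping.single v 1)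
       (of_nat (Poly_Mapping.lookup m v) * Poly_Mapping.lookup p m))"
  unfolding pder_def using assms by (intro sum.mono_neutral_left) (auto simp: in_keys_iff)

lemma pder_0 [simp]: "pder v 0 = 0"
  by (simp add: pder_def)

lemma pder_single:
  "pder v (Poly_Mapping.single m c) =
     Poly_Mapping.single (m - Poly_Mapping.single v 1) (of_nat (Poly_Mapping.lookup m v) * c)"
  by (subst pder_superset[of "{m}"]) auto

lemma pder_add: "pder v (p + q) = pder v p + pder v q"
proof -
  let ?S = "Poly_Mapping.keys p \<union> Poly_Mapping.keys q"
  have "Poly_Mapping.keys (p + q) \<subseteq> ?S" by (rule keys_add)
  then show ?thesis
    by (simp add: pder_superset[of ?S] lookup_add algebra_simps single_add sum.distrib)
qed

lemma pder_sum: "pder v (sum f A) = (\<Sum>a\<in>A. pder v (f a))"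
  by (induction A rule: infinite_finite_induct) (auto simp: pder_add)

lemma mpol_eq_sum_monomials:
  "p = (\<Sum>m \<in> Poly_Mapping.keys p. Poly_Mapping.single m (Poly_Mapping.lookup p m))"
  by (rule poly_mapping_eqI)
    (auto simp: lookup_sum lookup_single when_def in_keys_iff)

lemma pder_mult_single:
  "pder v (Poly_Mapping.single m a * Poly_Mapping.single n b) =
     Poly_Mapping.single m a * pder v (Poly_Mapping.single n b)
     + pder v (Poly_Mapping.single m a) * Poly_Mapping.single n b"
proof -
  let ?e = "Poly_Mapping.single v (1::nat)"
  have *: "x + (y - ?e) = x + y - ?e" if "Poly_Mapping.lookup y v \<noteq> 0" for x y
    using that
    by (intro poly_mapping_eqI) (auto simp: lookup_add lookup_minus lookup_single when_def)
  have 1: "Poly_Mapping.single (m + (n - ?e)) (a * (of_nat (Poly_Mapping.lookup n v) * b)) =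
      Poly_Mapping.single (m + n - ?e) (a * (of_nat (Poly_Mapping.lookup n v) * b))"
    using *[of n m] by (cases "Poly_Mapping.lookup n v = 0") simp_all
  have 2: "Poly_Mapping.single ((m - ?e) + n) (of_nat (Poly_Mapping.lookup m v) * a * b) =
      Poly_Mapping.single (m + n - ?e) (of_nat (Poly_Mapping.lookup m v) * a * b)"
    using *[of m n] by (cases "Poly_Mapping.lookup m v = 0") (simp_all add: add.commute)
  show ?thesis
    unfolding pder_single mult_single 1 2 lookup_add
    by (simp add: algebra_simps flip: single_add)
qed

lemma pder_mult: "pder v (p * q) = p * pder v q + pder v p * q"
proof -
  let ?s = "\<lambda>p m. Poly_Mapping.single m (Poly_Mapping.lookup p m)"
  let ?K = "Poly_Mapping.keys"
  have "pder v ((\<Sum>m\<in>?K p. ?s p m) * (\<Sum>n\<in>?K q. ?s q n)) =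
      (\<Sum>m\<in>?K p. ?s p m) * pder v (\<Sum>n\<in>?K q. ?s q n)
      + pder v (\<Sum>m\<in>?K p. ?s p m) * (\<Sum>n\<in>?K q. ?s q n)"
    by (simp add: sum_product pder_sum pder_mult_single sum.distrib)
  then show ?thesis
    by (simp flip: mpol_eq_sum_monomials)
qed

lemma pder_scale: "pder v (mscale c p) = mscale c (pder v p)"
  by (simp add: mscale_def pder_mult pder_single)

lemma derivation_add: "derivation V g (p + q) = derivation V g p + derivation V g q"
  by (simp add: derivation_def pder_add algebra_simps sum.distrib)

lemma derivation_scale: "derivation V g (mscale c p) = mscale c (derivation V g p)"
  by (simp add: derivation_def pder_scale) (simp add: mscale_def algebra_simps sum_distrib_left)

lemma derivation_mult:
  "derivation V g (p * q) = p * derivation V g q + derivation V g p * q"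
  by (simp add: derivation_def pder_mult algebra_simps sum.distrib
        sum_distrib_left sum_distrib_right)

lemma derivation_Var:
  assumes "finite V" "v \<in> V"
  shows "derivation V g (Var v) = g v"
proof -
  have "g w * pder w (Var v) = (if w = v then g v else 0)" for w
    by (auto simp: Var_def pder_single lookup_single when_def)
  then show ?thesis using assms by (simp add: derivation_def)
qed

lemma finite_vars: "finite (vars d)"
  by (simp add: vars_def)

lemma der_D_Var: "k < length d \<Longrightarrow> i \<le> d ! k \<Longrightarrow> der_D d (Var (k, i)) = of_nat i * Var (k, i - 1)"
  by (simp add: der_D_def derivation_Var finite_vars vars_def)

lemma der_Dstar_Var:
  "k < length d \<Longrightarrow> i \<le> d ! k \<Longrightarrow> der_Dstar d (Var (k, i)) = of_nat (d ! k - i) * Var (k, i + 1)"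
  by (simp add: der_Dstar_def derivation_Var finite_vars vars_def)

definition f_gen :: "nat list \<Rightarrow> complex \<Rightarrow> complex \<Rightarrow> complex" where
  "f_gen d t z = (\<Prod>k<length d. \<Prod>j\<le>d ! k. 1 / (1 - t * z powi (int (d ! k) - 2 * int j)))"

abbreviation dmax :: "nat list \<Rightarrow> nat" where
  "dmax d \<equiv> Max (set d)"

text \<open>\<open>\<beta> 0, \<dots>, \<beta> (2 * dmax d)\<close> are the exponents in the factorisation of \<open>f_gen d (t z^dmax) z\<close>.
  With \<open>1 / 0 = 0\<close> both sides vanish at the poles, so \<open>t\<close> needs no restriction.\<close>

definition is_beta :: "nat list \<Rightarrow> (nat \<Rightarrow> nat) \<Rightarrow> bool" where
  "is_beta d \<beta> \<longleftrightarrow>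
     (\<forall>t z. z \<noteq> 0 \<longrightarrow> f_gen d (t * z ^ dmax d) z = (\<Prod>i\<le>2 * dmax d. (1 / (1 - t * z ^ i)) ^ \<beta> i))"

lemma ex_is_beta: "\<exists>\<beta>. is_beta d \<beta>"
proof -
  define h where "h = (\<lambda>(k, j). dmax d + d ! k - 2 * j)"
  define \<beta> where "\<beta> i = card {x \<in> vars d. h x = i}" for i
  have le: "d ! k \<le> dmax d" if "k < length d" for k
    using that by simp
  have "f_gen d (t * z ^ dmax d) z = (\<Prod>i\<le>2 * dmax d. (1 / (1 - t * z ^ i)) ^ \<beta> i)"
    if z: "z \<noteq> 0" for t z
  proof -
    have "f_gen d (t * z ^ dmax d) z =
        (\<Prod>(k, j)\<in>vars d. 1 / (1 - t * z ^ dmax d * z powi (int (d ! k) - 2 * int j)))"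
      unfolding f_gen_def vars_def by (subst prod.Sigma) auto
    also have "\<dots> = (\<Prod>x\<in>vars d. 1 / (1 - t * z ^ h x))"
    proof (intro prod.cong refl, clarify)
      fix k j assume kj: "(k, j) \<in> vars d"
      then have "j \<le> d ! k" "d ! k \<le> dmax d"
        using le[of k] by (auto simp: vars_def)
      then have "2 * j \<le> dmax d + d ! k"
        by linarith
      then have "int (h (k, j)) = int (dmax d) + (int (d ! k) - 2 * int j)"
        by (simp add: h_def of_nat_diff)
      then have "z ^ h (k, j) = z ^ dmax d * z powi (int (d ! k) - 2 * int j)"
        using z by (metis power_int_add power_int_of_nat)
      then show "1 / (1 - t * z ^ dmax d * z powi (int (d ! k) - 2 * int j)) =
          1 / (1 - t * z ^ h (k, j))"
        by (simp add: mult.assoc)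
    qed
    also have "\<dots> = (\<Prod>i\<le>2 * dmax d. \<Prod>x\<in>{x \<in> vars d. h x = i}. 1 / (1 - t * z ^ h x))"
    proof (rule prod.group[symmetric])
      show "h ` vars d \<subseteq> {..2 * dmax d}"
      proof (rule image_subsetI)
        fix x assume "x \<in> vars d"
        then have "d ! fst x \<le> dmax d"
          using le[of "fst x"] by (auto simp: vars_def)
        then show "h x \<in> {..2 * dmax d}"
          by (simp add: h_def case_prod_beta)
      qed
    qed (simp_all add: finite_vars)
    also have "\<dots> = (\<Prod>i\<le>2 * dmax d. (1 / (1 - t * z ^ i)) ^ \<beta> i)"
      by (intro prod.cong refl) (simp add: \<beta>_def)
    finally show ?thesis .
  qed
  then show ?thesis
    unfolding is_beta_def by blast
qed

text \<open>\<open>A_val d \<beta> i k z\<close> is the value of \<open>A\<^sub>i\<^sub>,\<^sub>k\<close> at \<open>z\<close>. It is meaningful at generic \<open>z\<close>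
  (in particular for \<open>0 < |z| < 1\<close>), but at \<open>z = 0\<close> the formula divides by 0 and
  has a removable singularity; hence the use of \<open>remove_sings\<close> in the expansion.\<close>

definition A_val :: "nat list \<Rightarrow> (nat \<Rightarrow> nat) \<Rightarrow> nat \<Rightarrow> nat \<Rightarrow> complex \<Rightarrow> complex" where
  "A_val d \<beta> i k z =
     (-1) ^ (\<beta> i - k) / (fact (\<beta> i - k) * (z ^ i) ^ (\<beta> i - k)) *
     Lim (at (z powi (- int i)))
       ((deriv ^^ (\<beta> i - k)) (\<lambda>t. f_gen d (t * z ^ dmax d) z * (1 - t * z ^ i) ^ \<beta> i))"

definition A_fps :: "nat list \<Rightarrow> (nat \<Rightarrow> nat) \<Rightarrow> nat \<Rightarrow> nat \<Rightarrow> complex fps" where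
  "A_fps d \<beta> i k = fps_expansion (remove_sings (A_val d \<beta> i k)) 0"

definition \<phi> :: "nat \<Rightarrow> complex fps \<Rightarrow> complex fps" where
  "\<phi> n F = Abs_fps (\<lambda>i. fps_nth F (i * n))"

lemma phi_0: "\<phi> 0 F = fps_const (fps_nth F 0) / (1 - fps_X)"
proof -
  have "\<phi> 0 F = fps_const (fps_nth F 0) * Abs_fps (\<lambda>_. 1)"
    by (simp add: \<phi>_def fps_eq_iff)
  also have "Abs_fps (\<lambda>_. 1 :: complex) = inverse (1 - fps_X)"
    by (metis fps_inverse_gp' fps_inverse_idempotent fps_inverse_one' fps_nth_Abs_fps one_neq_zero)
  finally show ?thesis
    by (simp add: fps_divide_unit)
qed

end

theory Submission
  imports Defs
begin

text \<open>Give \<open>x_i^(k)\<close> the weight \<open>d_k - 2 i\<close>. Then \<open>D\<close> raises and \<open>D*\<close> lowers weights by 2, and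
  \<open>[D, D*]\<close> multiplies a polynomial of weight \<open>w\<close> by \<open>w\<close>, so each \<open>(K[X])_m\<close> is a representation
  of \<open>sl_2\<close>. It follows that \<open>D\<close> is injective on negative weights and maps onto all positive weights;
  with \<open>N(m, w)\<close> the number of monomials of degree \<open>m\<close> and weight \<open>w\<close>, rank-nullity gives
  \<open>dim (S_d)_m = N(m, 0) + N(m, 1)\<close> and \<open>dim (I_d)_m = N(m, 0) - N(m, 2)\<close>.

  The coefficient of \<open>t^m\<close> in \<open>f_d(t z^d*, z)\<close> is \<open>\<Sum>\<^sub>w N(m, w) z^(d* m - w)\<close>, so these dimensions are the
  coefficients of \<open>t^m z^(d* m)\<close> after multiplication by \<open>1 + z\<close> and \<open>1 - z^2\<close>. Expanding the
  partial fractions, \<open>A_(i,k) / (1 - t z^i)^k\<close> contributes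
  \<open>binomial (m + k - 1) (k - 1) * [z^((d* - i) m)] A_(i,k)\<close>, which is the operator
  \<open>F \<mapsto> (z^(k-1) \<phi> F)^((k-1)) / (k-1)!\<close> read off at \<open>z^m\<close>. The terms with \<open>i > d*\<close> drop out: for \<open>m > 0\<close> by
  degree, and for \<open>m = 0\<close> because \<open>\<beta>_0 > 0\<close> forces \<open>A_(i,k)(0) = 0\<close> for \<open>i > 0\<close>.\<close>

section \<open>Linear algebra on finitely supported polynomials\<close>

text \<open>The coordinates of \<open>x\<close> over \<open>C\<close> agree both with those over
  \<open>B\<close> and with those over \<open>C - B\<close>; a nonzero one would have its index in
  both sets.\<close>

lemma (in vector_space) independent_span_Diff:
  assumes "independent C" "B \<subseteq> C" "x \<in> span B" "x \<in> span (C - B)"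
  shows "x = 0"
proof -
  have "x \<in> span C"
    using assms span_mono by blast
  moreover have "representation C x b = 0" for b
    using representation_extend[OF assms(1) assms(3) assms(2)]
      representation_extend[OF assms(1) assms(4)] representation_ne_zero[of B x b]
      representation_ne_zero[of "C - B" x b] by auto
  ultimately show ?thesis
    using sum_nonzero_representation_eq[OF assms(1), of x] by simp
qed

text \<open>The polynomial space is infinite-dimensional, so the count is made inside a subspace
  \<open>W\<close> of a finite span. A basis \<open>B\<close> of the kernel in \<open>W\<close>
  extends to a basis \<open>C\<close> of \<open>W\<close>, and \<open>f\<close> carries
  \<open>C - B\<close> bijectively to a basis of the image.\<close>

lemma (in Vector_Spaces.linear) rank_nullity:
  assumes W: "vs1.subspace W" and fin: "finite S" "W \<subseteq> vs1.span S"
  shows "vs1.dim W = vs1.dim {x \<in> W. f x = 0} + vs2.dim (f ` W)"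
proof -
  let ?K = "{x \<in> W. f x = 0}"
  obtain B where B: "B \<subseteq> ?K" "vs1.independent B" "?K \<subseteq> vs1.span B"
    by (rule vs1.maximal_independent_subset)
  obtain C where C: "B \<subseteq> C" "C \<subseteq> W" "vs1.independent C" "W \<subseteq> vs1.span C"
    using vs1.maximal_independent_subset_extend[of B W] B
    by (metis (no_types, lifting) mem_Collect_eq subset_iff)
  have finC: "finite C"
    using vs1.independent_span_bound[OF fin(1) C(3)] C(2) fin(2) by blast
  have spC: "vs1.span C = W"
    using C W by (simp add: vs1.span_minimal subset_antisym)
  have inj: "inj_on f (vs1.span (C - B))"
  proof (subst inj_on_iff_eq_0[OF vs1.subspace_span], intro ballI impI)
    fix x assume x: "x \<in> vs1.span (C - B)" "f x = 0"
    then have "x \<in> ?K" using spC vs1.span_mono[of "C - B" C] by auto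
    then have "x \<in> vs1.span B" using B(3) by auto
    then show "x = 0" using vs1.independent_span_Diff[OF C(3,1)] x by blast
  qed
  have ind: "vs2.independent (f ` (C - B))"
    using independent_injective_image[OF vs1.independent_mono[OF C(3)] inj] by blast
  have "f ` C \<subseteq> insert 0 (f ` (C - B))"
    using B(1) by auto
  then have "vs2.span (f ` C) \<subseteq> vs2.span (f ` (C - B))"
    by (metis vs2.span_insert_0 vs2.span_mono)
  then have "vs2.span (f ` (C - B)) = vs2.span (f ` W)"
    by (metis (no_types, lifting) C(1) Diff_subset image_mono spC span_image subset_antisym vs2.span_mono vs2.span_span)
  then have "vs2.dim (f ` W) = card (f ` (C - B))"
    by (metis ind vs2.dim_eq_card)
  also have "\<dots> = card C - card B"
    using inj_on_subset[OF inj vs1.span_superset] C(1) finC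
    by (simp add: card_image card_Diff_subset finite_subset)
  finally have "vs2.dim (f ` W) = card C - card B" .
  moreover have "vs1.dim W = card C"
    using C vs1.basis_card_eq_dim by metis
  moreover have "vs1.dim ?K = card B"
    using B vs1.basis_card_eq_dim by metis
  ultimately show ?thesis
    using card_mono[OF finC C(1)] by simp
qed

section \<open>Coordinate subspaces spanned by monomials\<close>

abbreviation lookup where "lookup \<equiv> Poly_Mapping.lookup"
abbreviation keys where "keys \<equiv> Poly_Mapping.keys"
abbreviation single where "single \<equiv> Poly_Mapping.single"

text \<open>For finite \<open>M\<close> the dimension of this coordinate subspace is
  \<open>card M\<close>, which turns dimension counts into counts of monomials.\<close>

definition supported :: "(var \<Rightarrow>\<^sub>0 nat) set \<Rightarrow> 'k::zero mpol set" where
  "supported M = {p. keys p \<subseteq> M}"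

lemma lookup_mscale [simp]: "lookup (mscale c p) m = c * lookup p m"
proof -
  have "mscale c (\<Sum>m\<in>keys p. single m (lookup p m)) = (\<Sum>m\<in>keys p. single m (c * lookup p m))"
    by (simp add: mscale_def sum_distrib_left mult_single)
  then have "mscale c p = (\<Sum>m\<in>keys p. single m (c * lookup p m))"
    by (simp flip: mpol_eq_sum_monomials)
  then show ?thesis
    by (simp add: lookup_sum lookup_single when_def in_keys_iff)
qed

lemma subspace_supported: "mpol.subspace (supported M)"
  unfolding mpol.subspace_def supported_def
  by (auto simp: in_keys_iff lookup_add subset_iff) (metis add.right_neutral)

lemma supported_mono: "M \<subseteq> N \<Longrightarrow> supported M \<subseteq> supported N"
  by (auto simp: supported_def)

lemma span_singles: 
  "mpol.span ((\<lambda>m. single m (1::'k::field)) ` M) = supported M"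
proof
  show "mpol.span ((\<lambda>m. single m (1::'k)) ` M) \<subseteq> supported M"
    by (rule mpol.span_minimal[OF _ subspace_supported]) (auto simp: supported_def)
  show "supported M \<subseteq> mpol.span ((\<lambda>m. single m (1::'k)) ` M)"
  proof
    fix p :: "'k mpol" assume p: "p \<in> supported M"
    have "(\<Sum>m\<in>keys p. single m (lookup p m)) \<in> mpol.span ((\<lambda>m. single m 1) ` M)"
    proof (rule mpol.span_sum)
      fix m assume "m \<in> keys p"
      then have "single m 1 \<in> mpol.span ((\<lambda>m. single m (1::'k)) ` M)"
        using p by (intro mpol.span_base) (auto simp: supported_def)
      then have "mscale (lookup p m) (single m 1) \<in> mpol.span ((\<lambda>m. single m (1::'k)) ` M)"
        by (rule mpol.span_scale)
      then show "single m (lookup p m) \<in> mpol.span ((\<lambda>m. single m (1::'k)) ` M)"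
        by (simp add: mscale_def mult_single)
    qed
    then show "p \<in> mpol.span ((\<lambda>m. single m 1) ` M)"
      by (simp flip: mpol_eq_sum_monomials)
  qed
qed

lemma dim_supported:
  assumes "finite M"
  shows "mpol.dim (supported M :: 'k::field mpol set) = card M"
proof -
  have "mpol.independent ((\<lambda>m. single m (1::'k)) ` M)"
  proof (rule mpol.independent_if_scalars_zero)
    fix u :: "'k mpol \<Rightarrow> 'k" and x
    assume u: "(\<Sum>x\<in>(\<lambda>m. single m 1) ` M. mscale (u x) x) = 0"
      and "x \<in> (\<lambda>m. single m (1::'k)) ` M"
    then obtain m where m: "m \<in> M" "x = single m 1" by blast
    have "inj_on (\<lambda>m. single m (1::'k)) M"
      by (auto simp: inj_on_def dest: arg_cong[where f = keys])
    then have "(\<Sum>n\<in>M. mscale (u (single n 1)) (single n 1)) = 0"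
      using u by (simp add: sum.reindex)
    then have "lookup (\<Sum>n\<in>M. mscale (u (single n 1)) (single n 1)) m = 0"
      by simp
    then show "u x = 0"
      using m assms by (simp add: lookup_sum lookup_single when_def if_distrib sum.delta cong: if_cong)
  qed (use assms in simp)
  then have "mpol.dim (supported M :: 'k mpol set) = card ((\<lambda>m. single m (1::'k)) ` M)"
    by (metis mpol.dim_eq_card mpol.span_span span_singles)
  also have "\<dots> = card M"
    by (rule card_image) (auto simp: inj_on_def dest: arg_cong[where f = keys])
  finally show ?thesis .
qed

text \<open>Rank-nullity for a surjection between coordinate subspaces. The additive form avoids
  truncated subtraction.\<close>

lemma kernel_dim:
  assumes "Vector_Spaces.linear mscale mscale f" "finite M" "f ` supported M = supported N" "finite N"
  shows "mpol.dim {p \<in> supported M :: 'k::field mpol set. f p = 0} + card N = card M"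
proof -
  interpret Vector_Spaces.linear mscale mscale f by fact
  show ?thesis
    using rank_nullity[OF subspace_supported[of M], of "(\<lambda>m. single m 1) ` M"] assms
    by (simp add: span_singles dim_supported)
qed

section \<open>Weights and the commutator relation\<close>

definition monomials :: "var set \<Rightarrow> nat \<Rightarrow> (var \<Rightarrow>\<^sub>0 nat) set" where
  "monomials V m = {\<mu>. keys \<mu> \<subseteq> V \<and> total_deg \<mu> = m}"

lemma total_deg_superset:
  "finite V \<Longrightarrow> keys \<mu> \<subseteq> V \<Longrightarrow> total_deg \<mu> = (\<Sum>v\<in>V. lookup \<mu> v)"
  unfolding total_deg_def by (rule sum.mono_neutral_left) (auto simp: in_keys_iff)

lemma total_deg_add: "total_deg (\<mu> + \<nu>) = total_deg \<mu> + total_deg \<nu>"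
proof -
  have "keys (\<mu> + \<nu>) \<subseteq> keys \<mu> \<union> keys \<nu>"
    by (rule keys_add)
  then show ?thesis
    by (simp add: total_deg_superset[of "keys \<mu> \<union> keys \<nu>"] lookup_add sum.distrib)
qed

lemma total_deg_single [simp]: "total_deg (single v n) = n"
  by (simp add: total_deg_superset[of "{v}"])

lemma monomial_split:
  fixes \<mu> :: "var \<Rightarrow>\<^sub>0 nat"
  assumes "lookup \<mu> v > 0"
  shows "\<mu> = single v 1 + (\<mu> - single v 1)"
  using assms by (intro poly_mapping_eqI) (auto simp: lookup_add lookup_minus lookup_single when_def)

lemma monomials_0: "monomials V 0 = {0}"
  unfolding monomials_def total_deg_def
  by (auto simp: in_keys_iff intro!: poly_mapping_eqI)

lemma monomials_empty: "monomials {} (Suc m) = {}"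
  by (auto simp: monomials_def total_deg_def)

lemma keys_plus_nat: "keys (\<mu> + \<nu> :: var \<Rightarrow>\<^sub>0 nat) = keys \<mu> \<union> keys \<nu>"
  by (auto simp: in_keys_iff lookup_add)

text \<open>A monomial either avoids \<open>v\<close> or is divisible by it. This recursion drives
  both the finiteness proof and the generating function.\<close>

lemma monomials_insert:
  assumes "v \<notin> V"
  shows "monomials (insert v V) (Suc m) =
    monomials V (Suc m) \<union> (\<lambda>\<mu>. single v 1 + \<mu>) ` monomials (insert v V) m" (is "?L = ?A \<union> ?B")
    and "monomials V (Suc m) \<inter> (\<lambda>\<mu>. single v 1 + \<mu>) ` monomials (insert v V) m = {}"
proof -
  show "?L = ?A \<union> ?B"
  proof (intro set_eqI iffI)
    fix \<mu> assume \<mu>: "\<mu> \<in> ?L"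
    show "\<mu> \<in> ?A \<union> ?B"
    proof (cases "lookup \<mu> v = 0")
      case True
      then have "\<mu> \<in> ?A"
        using \<mu> by (auto simp: monomials_def in_keys_iff)
      then show ?thesis ..
    next
      case False
      then have *: "\<mu> = single v 1 + (\<mu> - single v 1)"
        by (intro monomial_split) simp
      have "total_deg \<mu> = 1 + total_deg (\<mu> - single v 1)" "keys (\<mu> - single v 1) \<subseteq> keys \<mu>"
        by (subst *, simp add: total_deg_add) (auto simp: in_keys_iff lookup_minus)
      then have "\<mu> - single v 1 \<in> monomials (insert v V) m"
        using \<mu> by (auto simp: monomials_def)
      then show ?thesis using * by blast
    qed
  next
    fix \<mu> assume "\<mu> \<in> ?A \<union> ?B"
    then show "\<mu> \<in> ?L"
      by (auto simp: monomials_def total_deg_add keys_plus_nat)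
  qed
  show "?A \<inter> ?B = {}"
    using assms by (auto simp: monomials_def keys_plus_nat)
qed

lemma finite_monomials:
  assumes "finite V"
  shows "finite (monomials V m)"
  using assms
proof (induction V arbitrary: m rule: finite_induct)
  case empty
  then show ?case by (cases m) (auto simp: monomials_0 monomials_empty)
next
  case (insert v V)
  show ?case
  proof (induction m)
    case (Suc m)
    then show ?case using insert by (simp add: monomials_insert)
  qed (simp add: monomials_0)
qed

definition wt :: "nat list \<Rightarrow> (var \<Rightarrow>\<^sub>0 nat) \<Rightarrow> int" where
  "wt d \<mu> = (\<Sum>(k, i)\<in>vars d. (int (d ! k) - 2 * int i) * int (lookup \<mu> (k, i)))"

lemma wt_add: "wt d (\<mu> + \<nu>) = wt d \<mu> + wt d \<nu>"
  unfolding wt_def sum.distrib[symmetric]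
  by (intro sum.cong) (auto simp: lookup_add algebra_simps)

lemma wt_0 [simp]: "wt d 0 = 0"
  by (simp add: wt_def)

lemma wt_single: "(k, i) \<in> vars d \<Longrightarrow> wt d (single (k, i) (Suc 0)) = int (d ! k) - 2 * int i"
proof -
  assume "(k, i) \<in> vars d"
  have "wt d (single (k, i) (Suc 0)) = (\<Sum>x\<in>vars d. if x = (k, i) then int (d ! k) - 2 * int i else 0)"
    unfolding wt_def by (intro sum.cong) (auto simp: lookup_single when_def split: if_splits)
  then show ?thesis
    using \<open>(k, i) \<in> vars d\<close> by (simp add: finite_vars)
qed

definition wmonos :: "nat list \<Rightarrow> nat \<Rightarrow> int \<Rightarrow> (var \<Rightarrow>\<^sub>0 nat) set" where
  "wmonos d m w = {\<mu> \<in> monomials (vars d) m. wt d \<mu> = w}"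

text \<open>The terms of \<open>der_D\<close> and \<open>der_Dstar\<close> are such replacements,
  with \<open>j = i - 1\<close> and \<open>j = i + 1\<close>.\<close>

lemma wmonos_replace:
  assumes "\<mu> \<in> wmonos d m w" "lookup \<mu> (k, i) > 0" "(k, j) \<in> vars d"
  shows "single (k, j) 1 + (\<mu> - single (k, i) 1) \<in> wmonos d m (w + 2 * int i - 2 * int j)"
proof -
  let ?\<nu> = "\<mu> - single (k, i) 1"
  have *: "\<mu> = single (k, i) 1 + ?\<nu>"
    using assms(2) by (rule monomial_split)
  have ki: "(k, i) \<in> vars d"
    using assms by (auto simp: wmonos_def monomials_def in_keys_iff)
  have "total_deg \<mu> = 1 + total_deg ?\<nu>" "wt d \<mu> = int (d ! k) - 2 * int i + wt d ?\<nu>"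
     "keys ?\<nu> \<subseteq> keys \<mu>"
    using arg_cong[OF *, of total_deg] arg_cong[OF *, of "wt d"] ki
    by (auto simp: total_deg_add wt_add wt_single in_keys_iff lookup_minus)
  then show ?thesis
    using assms ki by (auto simp: wmonos_def monomials_def total_deg_add wt_add wt_single keys_plus_nat)
qed

lemma linear_derivation: "Vector_Spaces.linear mscale mscale (derivation V g)"
  by unfold_locales (simp_all add: derivation_add derivation_scale)

lemmas linear_D = linear_derivation[of "vars d" "\<lambda>(k, i). of_nat i * Var (k, i - 1)" for d, folded der_D_def]
lemmas linear_Dstar = linear_derivation[of "vars d" "\<lambda>(k, i). of_nat (d ! k - i) * Var (k, i + 1)" for d, folded der_Dstar_def]

lemma of_nat_mpol: "of_nat n * p = mscale (of_nat n) p"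
  by (simp add: mscale_def)

lemma of_int_mpol: "of_int n * p = mscale (of_int n) p"
  by (simp add: mscale_def)

lemma of_nat_mult_single: "of_nat n * single \<mu> c = single \<mu> (of_nat n * c)"
  by (metis add_0 mult_single single_of_nat)

lemma linear_supported:
  assumes f: "Vector_Spaces.linear mscale mscale (f :: 'k::field mpol \<Rightarrow> 'k mpol)"
    and "\<And>\<mu>. \<mu> \<in> M \<Longrightarrow> f (single \<mu> 1) \<in> supported N" and p: "p \<in> supported M"
  shows "f p \<in> supported N"
proof -
  interpret Vector_Spaces.linear mscale mscale f by fact
  have "f ` mpol.span ((\<lambda>m. single m 1) ` M) \<subseteq> supported N"
    unfolding span_image[symmetric] using assms(2) by (intro mpol.span_minimal subspace_supported) auto
  then show ?thesis
    using p by (auto simp: span_singles)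
qed

lemma D_supported:
  assumes "p \<in> supported (wmonos d m w)"
  shows "der_D d (p :: 'k::field mpol) \<in> supported (wmonos d m (w + 2))"
proof (rule linear_supported[OF linear_D _ assms])
  fix \<mu> assume \<mu>: "\<mu> \<in> wmonos d m w"
  show "der_D d (single \<mu> 1 :: 'k mpol) \<in> supported (wmonos d m (w + 2))"
    unfolding der_D_def derivation_def
  proof (rule mpol.subspace_sum[OF subspace_supported])
    fix v assume "v \<in> vars d"
    then obtain k i where v: "v = (k, i)" "(k, i) \<in> vars d" by (cases v) auto
    have "mscale (of_nat i * of_nat (lookup \<mu> v)) (single (single (k, i - 1) 1 + (\<mu> - single v 1)) 1)
       \<in> supported (wmonos d m (w + 2))" 
    \<comment> \<open>For \<open>i = 0\<close> the truncated \<open>i - 1\<close> is harmless,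
      because the factor \<open>i\<close> removes the term.\<close>
    proof (cases "i = 0 \<or> lookup \<mu> v = 0")
      case False
      then have "single (k, i - 1) 1 + (\<mu> - single v 1) \<in> wmonos d m (w + 2)"
        using wmonos_replace[OF \<mu>, of k i "i - 1"] v by (auto simp: vars_def of_nat_diff)
      then show ?thesis
        by (simp add: mscale_def mult_single supported_def)
    qed (auto simp: supported_def mscale_def)
    then show "(case v of (k, i) \<Rightarrow> of_nat i * Var (k, i - 1)) * pder v (single \<mu> (1::'k)) \<in> supported (wmonos d m (w + 2))"
      by (simp add: v Var_def pder_single mscale_def mult_single of_nat_mult_single mult.assoc del: of_nat_diff)
  qed
qed

lemma Dstar_supported:
  assumes "p \<in> supported (wmonos d m w)"
  shows "der_Dstar d (p :: 'k::field mpol) \<in> supported (wmonos d m (w - 2))"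
proof (rule linear_supported[OF linear_Dstar _ assms])
  fix \<mu> assume \<mu>: "\<mu> \<in> wmonos d m w"
  show "der_Dstar d (single \<mu> 1 :: 'k mpol) \<in> supported (wmonos d m (w - 2))"
    unfolding der_Dstar_def derivation_def
  proof (rule mpol.subspace_sum[OF subspace_supported])
    fix v assume "v \<in> vars d"
    then obtain k i where v: "v = (k, i)" "(k, i) \<in> vars d" by (cases v) auto
    have "mscale (of_nat (d ! k - i) * of_nat (lookup \<mu> v)) (single (single (k, i + 1) 1 + (\<mu> - single v 1)) 1)
       \<in> supported (wmonos d m (w - 2))" 
    \<comment> \<open>For \<open>i = d ! k\<close> the variable \<open>(k, i + 1)\<close> lies
      outside \<open>vars d\<close>, but the factor \<open>d ! k - i\<close> removes the
      term.\<close>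
    proof (cases "d ! k = i \<or> lookup \<mu> v = 0")
      case False
      then have "single (k, i + 1) 1 + (\<mu> - single v 1) \<in> wmonos d m (w - 2)"
        using wmonos_replace[OF \<mu>, of k i "i + 1"] v by (auto simp: vars_def algebra_simps)
      then show ?thesis
        by (simp add: mscale_def mult_single supported_def)
    qed (auto simp: supported_def mscale_def)
    then show "(case v of (k, i) \<Rightarrow> of_nat (d ! k - i) * Var (k, i + 1)) * pder v (single \<mu> (1::'k)) \<in> supported (wmonos d m (w - 2))"
      by (simp add: v Var_def pder_single mscale_def mult_single of_nat_mult_single mult.assoc del: of_nat_diff)
  qed
qed

section \<open>The commutator as the weight operator\<close>

definition commutator :: "nat list \<Rightarrow> 'k::comm_ring_1 mpol \<Rightarrow> 'k mpol" where
  "commutator d p = der_D d (der_Dstar d p) - der_Dstar d (der_D d p)"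

lemma der_of_nat [simp]: "der_D d (of_nat n * p) = of_nat n * der_D d p"
   "der_Dstar d (of_nat n * p) = of_nat n * der_Dstar d p"
  by (simp_all add: of_nat_mpol der_D_def der_Dstar_def derivation_scale)

text \<open>The commutator of two derivations is again a derivation: the mixed products
  cancel.\<close>

lemma commutator_mult: "commutator d (p * q) = p * commutator d q + commutator d p * q"
  by (simp add: commutator_def der_D_def der_Dstar_def derivation_mult derivation_add algebra_simps)

text \<open>The eigenvalue comes from
  \<open>(d_k - i) (i + 1) - i (d_k - i + 1) = d_k - 2 i\<close>.\<close>

lemma commutator_Var:
  assumes "(k, i) \<in> vars d"
  shows "commutator d (Var (k, i)) = of_int (int (d ! k) - 2 * int i) * Var (k, i)"
proof -
  have k: "k < length d" "i \<le> d ! k" using assms by (auto simp: vars_def)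
  have zero: "der_D d 0 = (0 :: 'a mpol)" "der_Dstar d 0 = (0 :: 'a mpol)"
    by (simp_all add: der_D_def der_Dstar_def derivation_def)
  have 1: "der_D d (der_Dstar d (Var (k, i))) = of_nat (d ! k - i) * of_nat (i + 1) * (Var (k, i) :: 'a mpol)"
    using k by (cases "d ! k = i") (simp_all add: der_Dstar_Var der_D_Var mult.assoc zero del: of_nat_diff)
  have 2: "der_Dstar d (der_D d (Var (k, i))) = of_nat i * of_nat (d ! k - i + 1) * (Var (k, i) :: 'a mpol)"
    using k by (cases "i = 0") (simp_all add: der_Dstar_Var der_D_Var mult.assoc Suc_diff_le zero del: of_nat_diff)
  have "(of_nat (d ! k - i) * of_nat (i + 1) - of_nat i * of_nat (d ! k - i + 1)) =
        (of_int (int (d ! k) - 2 * int i) :: 'a mpol)"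
    using k by (simp add: of_nat_diff algebra_simps)
  then show ?thesis
    unfolding commutator_def 1 2 by (metis left_diff_distrib)
qed

text \<open>A derivation that multiplies each variable by its weight multiplies a monomial by the
  sum of the weights; the induction splits off one variable at a time.\<close>

lemma commutator_monomial:
  "keys \<mu> \<subseteq> vars d \<Longrightarrow> commutator d (single \<mu> 1) = of_int (wt d \<mu>) * single \<mu> (1::'k::comm_ring_1)"
proof (induction "total_deg \<mu>" arbitrary: \<mu>)
  case 0
  then have "\<mu> = 0"
    by (auto simp: total_deg_def in_keys_iff intro!: poly_mapping_eqI)
  \<comment> \<open>The Leibniz rule for \<open>1 = 1 * 1\<close> gives \<open>c = c + c\<close> for
    the commutator \<open>c\<close> of 1, hence \<open>c = 0\<close>.\<close>
  then show ?case using commutator_mult[of d 1 1] by simp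
next
  case (Suc n)
  then have "keys \<mu> \<noteq> {}"
    by (auto simp: total_deg_def)
  then obtain k i where "(k, i) \<in> keys \<mu>"
    by fast
  then have ki: "lookup \<mu> (k, i) > 0" "(k, i) \<in> vars d"
    using Suc(3) by (auto simp: in_keys_iff) 
  define \<nu> where "\<nu> = \<mu> - single (k, i) 1"
  have \<mu>: "\<mu> = single (k, i) 1 + \<nu>"
    unfolding \<nu>_def by (rule monomial_split[OF ki(1)])
  have "n = total_deg \<nu>" "keys \<nu> \<subseteq> vars d"
    using Suc(2,3) by (auto simp: \<mu> total_deg_add keys_plus_nat)
  then have IH: "commutator d (single \<nu> 1) = of_int (wt d \<nu>) * single \<nu> (1::'k)"
    using Suc(1) by blast
  have "single \<mu> (1::'k) = Var (k, i) * single \<nu> 1"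
    by (simp add: \<mu> Var_def mult_single)
  then show ?case
    by (simp add: commutator_mult commutator_Var[OF ki(2)] IH)
      (simp add: \<mu> wt_add wt_single[OF ki(2)] algebra_simps)
qed

lemma lookup_commutator:
  assumes "p \<in> poly_algebra d"
  shows "lookup (commutator d (p :: 'k::field mpol)) \<mu> = of_int (wt d \<mu>) * lookup p \<mu>"
proof -
  interpret D: Vector_Spaces.linear mscale mscale "der_D d :: 'k mpol \<Rightarrow> 'k mpol" by (rule linear_D)
  interpret Ds: Vector_Spaces.linear mscale mscale "der_Dstar d :: 'k mpol \<Rightarrow> 'k mpol" by (rule linear_Dstar)
  interpret C: Vector_Spaces.linear mscale mscale "commutator d :: 'k mpol \<Rightarrow> 'k mpol"
    by unfold_locales (simp_all add: commutator_def D.add Ds.add D.scale Ds.scale algebra_simps mpol.scale_right_diff_distrib)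
  have "commutator d (\<Sum>\<nu>\<in>keys p. mscale (lookup p \<nu>) (single \<nu> 1)) = (\<Sum>\<nu>\<in>keys p. mscale (lookup p \<nu>) (of_int (wt d \<nu>) * single \<nu> 1))"
    unfolding C.sum C.scale using assms by (intro sum.cong refl) (auto simp: poly_algebra_def commutator_monomial)
  moreover have "(\<Sum>\<nu>\<in>keys p. mscale (lookup p \<nu>) (single \<nu> 1)) = p"
    by (simp add: mscale_def mult_single flip: mpol_eq_sum_monomials)
  ultimately show ?thesis
    by (auto simp: lookup_sum of_int_mpol lookup_single when_def if_distrib in_keys_iff cong: if_cong)
qed

section \<open>Dimensions of the invariants\<close>

lemma supported_wmonos_poly_algebra: "supported (wmonos d m w) \<subseteq> poly_algebra d"
  by (auto simp: supported_def wmonos_def monomials_def poly_algebra_def)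

text \<open>The rule for moving \<open>der_D\<close> past \<open>der_Dstar\<close> on a single
  weight space.\<close>

lemma D_Dstar:
  assumes "p \<in> supported (wmonos d m w)"
  shows "der_D d (der_Dstar d (p :: 'k::field mpol)) = der_Dstar d (der_D d p) + mscale (of_int w) p"
proof -
  have "commutator d p = mscale (of_int w) p"
  proof (rule poly_mapping_eqI)
    fix \<mu>
    have "p \<in> poly_algebra d"
      using assms supported_wmonos_poly_algebra by blast
    then have "lookup (commutator d p) \<mu> = of_int (wt d \<mu>) * lookup p \<mu>"
      by (rule lookup_commutator)
    also have "\<dots> = of_int w * lookup p \<mu>"
      using assms by (cases "\<mu> \<in> keys p") (auto simp: supported_def wmonos_def in_keys_iff)
    finally show "lookup (commutator d p) \<mu> = lookup (mscale (of_int w) p) \<mu>"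
      by simp
  qed
  then show ?thesis
    by (simp add: commutator_def algebra_simps)
qed

section \<open>Iterates of \<open>D\<close> and \<open>D*\<close> on weight spaces\<close>

lemma funpow_supported:
  assumes "p \<in> supported (wmonos d m w)"
  shows "(der_D d ^^ n) (p :: 'k::field mpol) \<in> supported (wmonos d m (w + 2 * int n))"
    and "(der_Dstar d ^^ n) p \<in> supported (wmonos d m (w - 2 * int n))"
proof -
  show "(der_D d ^^ n) p \<in> supported (wmonos d m (w + 2 * int n))"
  proof (induction n)
    case (Suc n)
    then show ?case using D_supported[OF Suc] by (simp add: algebra_simps)
  qed (use assms in simp)
  show "(der_Dstar d ^^ n) p \<in> supported (wmonos d m (w - 2 * int n))"
  proof (induction n)
    case (Suc n)
    then show ?case using Dstar_supported[OF Suc] by (simp add: algebra_simps)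
  qed (use assms in simp)
qed

lemma finite_wt_bound: "\<exists>B. \<forall>w. \<bar>w\<bar> > B \<longrightarrow> wmonos d m w = {}"
proof -
  have "finite ((\<lambda>\<mu>. \<bar>wt d \<mu>\<bar>) ` monomials (vars d) m)"
    by (simp add: finite_monomials finite_vars)
  then obtain B where "\<forall>x\<in>(\<lambda>\<mu>. \<bar>wt d \<mu>\<bar>) ` monomials (vars d) m. x \<le> B"
    by (meson bdd_above.E bdd_above_finite)
  then show ?thesis
    by (intro exI[of _ B]) (fastforce simp: wmonos_def)
qed

text \<open>Each application moves the weight by 2, and only finitely many weights occur in a given
  degree.\<close>

lemma D_nilpotent:
  assumes "p \<in> supported (wmonos d m w)"
  shows "\<exists>n. (der_D d ^^ n) (p :: 'k::field mpol) = 0" "\<exists>n. (der_Dstar d ^^ n) p = 0"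
proof -
  obtain B where B: "\<And>w. \<bar>w\<bar> > B \<Longrightarrow> wmonos d m w = {}"
    using finite_wt_bound by blast
  define n where "n = nat (\<bar>B\<bar> + \<bar>w\<bar> + 1)"
  have "\<bar>w + 2 * int n\<bar> > B" "\<bar>w - 2 * int n\<bar> > B"
    by (auto simp: n_def)
  then have *: "wmonos d m (w + 2 * int n) = {}" "wmonos d m (w - 2 * int n) = {}"
    using B by auto
  show "\<exists>n. (der_D d ^^ n) p = 0" "\<exists>n. (der_Dstar d ^^ n) p = 0"
    using funpow_supported[OF assms, of n] unfolding * by (auto simp: supported_def)
qed

text \<open>For \<open>D p = 0\<close> and \<open>w < 0\<close>, \<open>D D*^(n+1) p\<close> is a nonzero multiple of \<open>D*^n p\<close>, but \<open>D*\<close> is nilpotent.\<close>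

lemma D_injective:
  assumes p: "p \<in> supported (wmonos d m w)" and w: "w < 0" and D: "der_D d (p :: 'k::field_char_0 mpol) = 0"
  shows "p = 0"
proof -
  interpret D: Vector_Spaces.linear mscale mscale "der_D d :: 'k mpol \<Rightarrow> 'k mpol" by (rule linear_D)
  interpret Ds: Vector_Spaces.linear mscale mscale "der_Dstar d :: 'k mpol \<Rightarrow> 'k mpol" by (rule linear_Dstar)
  \<comment> \<open>The factor is the sum of the weights \<open>w - 2 j\<close> for
    \<open>j <= n\<close>, collected while \<open>der_D\<close> moves right until it meets
    \<open>p\<close> and gives 0.\<close>
  have *: "der_D d ((der_Dstar d ^^ Suc n) p) =
      mscale (of_int (int (Suc n) * (w - int n))) ((der_Dstar d ^^ n) p)" for n
  proof (induction n)
    case 0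
    then show ?case using D_Dstar[OF p] D by (simp add: Ds.zero)
  next
    case (Suc n)
    have "der_D d ((der_Dstar d ^^ Suc (Suc n)) p) = der_Dstar d (der_D d ((der_Dstar d ^^ Suc n) p))
       + mscale (of_int (w - 2 * int (Suc n))) ((der_Dstar d ^^ Suc n) p)"
      using D_Dstar[OF funpow_supported(2)[OF p, of "Suc n"]] by simp
    also have "\<dots> = mscale (of_int (int (Suc n) * (w - int n)) + of_int (w - 2 * int (Suc n))) ((der_Dstar d ^^ Suc n) p)"
      unfolding Suc Ds.scale by (simp add: mpol.scale_left_distrib)
    also have "int (Suc n) * (w - int n) + (w - 2 * int (Suc n)) = int (Suc (Suc n)) * (w - int (Suc n))"
      by (simp add: algebra_simps)
    then have "(of_int (int (Suc n) * (w - int n)) + of_int (w - 2 * int (Suc n)) :: 'k) = of_int (int (Suc (Suc n)) * (w - int (Suc n)))"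
      by (metis of_int_add)
    finally show ?case .
  qed
  obtain N where "(der_Dstar d ^^ N) p = 0"
    using D_nilpotent[OF p] by blast
  then show "p = 0"
  proof (induction N)
    case (Suc n)
    then have "mscale (of_int (int (Suc n) * (w - int n))) ((der_Dstar d ^^ n) p) = 0"
      using *[of n] D.zero by metis
    moreover have "int (Suc n) * (w - int n) \<noteq> 0"
      using w by auto
    ultimately have "(der_Dstar d ^^ n) p = 0"
      by (metis mpol.scale_eq_0_iff of_int_eq_0_iff)
    then show ?case by (rule Suc.IH)
  qed simp
qed

text \<open>Induction on the nilpotency order of \<open>p\<close> under \<open>D\<close>: since \<open>D^(n+1) D* p\<close> is a nonzero multiple of
  \<open>D^n p\<close> when \<open>D^(n+1) p = 0\<close>, subtracting a multiple of \<open>D D* p\<close> from \<open>p\<close> lowers the order.\<close>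

lemma D_surjective:
  assumes p: "p \<in> supported (wmonos d m w)" and w: "w > 0"
  shows "\<exists>q\<in>supported (wmonos d m (w - 2)). der_D d q = (p :: 'k::field_char_0 mpol)"
proof -
  interpret D: Vector_Spaces.linear mscale mscale "der_D d :: 'k mpol \<Rightarrow> 'k mpol" by (rule linear_D)
  interpret Ds: Vector_Spaces.linear mscale mscale "der_Dstar d :: 'k mpol \<Rightarrow> 'k mpol" by (rule linear_Dstar)
  interpret Dn: Vector_Spaces.linear mscale mscale "der_D d ^^ n :: 'k mpol \<Rightarrow> 'k mpol" for n
  proof unfold_locales
    show "(der_D d ^^ n) (p + q) = (der_D d ^^ n) p + (der_D d ^^ n) q" for p q :: "'k mpol"
      by (induction n) (simp_all add: D.add)
    show "(der_D d ^^ n) (mscale c p) = mscale c ((der_D d ^^ n) p)" for c and p :: "'k mpol"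
      by (induction n) (simp_all add: D.scale)
  qed
  \<comment> \<open>The factor is the sum of the weights \<open>w + 2 j\<close> for
    \<open>j <= n\<close>. The formula is kept general in \<open>p\<close>, since the induction
    below replaces \<open>p\<close> by \<open>p - der_D d r\<close>.\<close>
  have *: "(der_D d ^^ Suc n) (der_Dstar d p) = der_Dstar d ((der_D d ^^ Suc n) p) +
      mscale (of_int (int (Suc n) * (w + int n))) ((der_D d ^^ n) p)" 
    if p: "p \<in> supported (wmonos d m w)" for n and p :: "'k mpol"
  proof (induction n)
    case 0
    then show ?case using D_Dstar[OF p] by simp
  next
    case (Suc n)
    have "(der_D d ^^ Suc (Suc n)) (der_Dstar d p) = der_D d (der_Dstar d ((der_D d ^^ Suc n) p)) +
        mscale (of_int (int (Suc n) * (w + int n))) ((der_D d ^^ Suc n) p)"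
      using arg_cong[OF Suc, of "der_D d"] by (simp add: D.add D.scale)
    also have "\<dots> = der_Dstar d ((der_D d ^^ Suc (Suc n)) p) + 
        mscale (of_int (w + 2 * int (Suc n)) + of_int (int (Suc n) * (w + int n))) ((der_D d ^^ Suc n) p)"
      using D_Dstar[OF funpow_supported(1)[OF p, of "Suc n"]] by (simp add: mpol.scale_left_distrib)
    also have "w + 2 * int (Suc n) + int (Suc n) * (w + int n) = int (Suc (Suc n)) * (w + int (Suc n))"
      by (simp add: algebra_simps)
    then have "(of_int (w + 2 * int (Suc n)) + of_int (int (Suc n) * (w + int n)) :: 'k) = of_int (int (Suc (Suc n)) * (w + int (Suc n)))"
      by (metis of_int_add)
    finally show ?case .
  qed
  obtain N where "(der_D d ^^ N) p = 0"
    using D_nilpotent[OF p] by blast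
  then show ?thesis
    using p
  proof (induction N arbitrary: p)
    case 0
    then show ?case using D.zero mpol.subspace_0[OF subspace_supported] by force
  next
    case (Suc n)
    \<comment> \<open>This scaling makes \<open>der_D d r\<close> and \<open>p\<close> agree under
      the \<open>n\<close>-th power of \<open>der_D\<close>.\<close>
    define c :: 'k where "c = inverse (of_int (int (Suc n) * (w + int n)))"
    have "int (Suc n) * (w + int n) \<noteq> 0"
      using w by auto
    then have c: "c * of_int (int (Suc n) * (w + int n)) = 1"
      unfolding c_def by (metis left_inverse of_int_eq_0_iff)
    define r where "r = mscale c (der_Dstar d p)"
    have r: "r \<in> supported (wmonos d m (w - 2))"
      unfolding r_def by (intro mpol.subspace_scale[OF subspace_supported] Dstar_supported Suc.prems)
    have "(der_D d ^^ n) (der_D d (der_Dstar d p)) = mscale (of_int (int (Suc n) * (w + int n))) ((der_D d ^^ n) p)"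
      using *[OF Suc.prems(2), of n] Suc.prems(1) by (simp add: funpow_swap1 Ds.zero)
    then have "(der_D d ^^ n) (p - der_D d r) = 0"
      unfolding r_def D.scale Dn.diff Dn.scale using c by simp
    moreover have "p - der_D d r \<in> supported (wmonos d m w)"
      using D_supported[OF r] Suc.prems by (intro mpol.subspace_diff[OF subspace_supported]) simp_all
    ultimately obtain q where "q \<in> supported (wmonos d m (w - 2))" "der_D d q = p - der_D d r"
      using Suc.IH by blast
    then show ?case
      using r by (intro bexI[of _ "q + r"]) (auto simp: D.add intro: mpol.subspace_add[OF subspace_supported])
  qed
qed

section \<open>Decomposition by weight and the dimension count\<close>

definition wpart :: "nat list \<Rightarrow> int \<Rightarrow> 'k::zero mpol \<Rightarrow> 'k mpol" where
  "wpart d w p = Poly_Mapping.mapp (\<lambda>\<mu> c. if wt d \<mu> = w then c else 0) p"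

lemma lookup_wpart [simp]: "lookup (wpart d w p) \<mu> = (if wt d \<mu> = w then lookup p \<mu> else 0)"
  by (auto simp: wpart_def lookup_mapp in_keys_iff when_def)

definition monos_ge :: "nat list \<Rightarrow> nat \<Rightarrow> int \<Rightarrow> (var \<Rightarrow>\<^sub>0 nat) set" where
  "monos_ge d m r = {\<mu> \<in> monomials (vars d) m. wt d \<mu> \<ge> r}"

lemma wpart_supported:
  "p \<in> supported (monomials (vars d) m) \<Longrightarrow> wpart d w p \<in> supported (wmonos d m w)"
  by (auto simp: supported_def wmonos_def in_keys_iff split: if_splits)

lemma sum_wpart:
  assumes "finite I" "wt d ` keys p \<subseteq> I"
  shows "(\<Sum>w\<in>I. wpart d w p) = (p :: 'k::comm_monoid_add mpol)"
proof (rule poly_mapping_eqI)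
  fix \<mu>
  show "lookup (\<Sum>w\<in>I. wpart d w p) \<mu> = lookup p \<mu>"
    using assms by (cases "\<mu> \<in> keys p") (auto simp: lookup_sum in_keys_iff)
qed

text \<open>Since \<open>der_D\<close> shifts every weight by 2, the images of different weight
  components share no monomial and vanish separately; components of negative weight are then 0 by
  injectivity.\<close>

lemma D_kernel_wt_nonneg:
  assumes p: "p \<in> supported (monomials (vars d) m)" and D: "der_D d (p :: 'k::field_char_0 mpol) = 0"
  shows "p \<in> supported (monos_ge d m 0)"
proof -
  interpret D: Vector_Spaces.linear mscale mscale "der_D d :: 'k mpol \<Rightarrow> 'k mpol" by (rule linear_D)
  have zero: "der_D d (wpart d w p) = 0" if "w \<in> wt d ` keys p" for w
  proof (rule poly_mapping_eqI)
    fix \<mu>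
    have *: "lookup (der_D d (wpart d w' p)) \<mu> = 0" if "wt d \<mu> \<noteq> w' + 2" for w'
      using D_supported[OF wpart_supported[OF p, of w']] that
      by (auto simp: supported_def wmonos_def in_keys_iff)
    have "0 = lookup (\<Sum>w'\<in>wt d ` keys p. der_D d (wpart d w' p)) \<mu>"
      by (simp add: D sum_wpart flip: D.sum)
    \<comment> \<open>A monomial of weight \<open>w + 2\<close> in the image can come only from the
      component of weight \<open>w\<close>.\<close>
    also have "\<dots> = (\<Sum>w'\<in>wt d ` keys p. if w' = w then lookup (der_D d (wpart d w p)) \<mu> else 0)" if "wt d \<mu> = w + 2"
      unfolding lookup_sum using that by (intro sum.cong) (auto intro!: *)
    also have "\<dots> = lookup (der_D d (wpart d w p)) \<mu>"
      using that by simp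
    finally show "lookup (der_D d (wpart d w p)) \<mu> = lookup 0 \<mu>"
      using * by fastforce
  qed
  have "wt d \<mu> \<ge> 0" if \<mu>: "\<mu> \<in> keys p" for \<mu>
  proof (rule ccontr)
    assume "\<not> wt d \<mu> \<ge> 0"
    then have "wpart d (wt d \<mu>) p = 0"
      using D_injective[OF wpart_supported[OF p]] zero \<mu> by simp
    then have "lookup (wpart d (wt d \<mu>) p) \<mu> = 0"
      by simp
    then show False
      using \<mu> by (simp add: in_keys_iff)
  qed
  then show ?thesis
    using p by (auto simp: supported_def monos_ge_def)
qed

lemma wmonos_subset_monos_ge: "w \<ge> r \<Longrightarrow> wmonos d m w \<subseteq> monos_ge d m r"
  by (auto simp: wmonos_def monos_ge_def)

text \<open>Weights at least 0 are raised to weights at least 2. Conversely, surjectivity onto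
  positive weights gives each monomial of weight at least 2 a preimage of weight at least 0.\<close>

lemma D_image_ge: "der_D d ` supported (monos_ge d m 0) = (supported (monos_ge d m 2) :: 'k::field_char_0 mpol set)"
proof -
  interpret D: Vector_Spaces.linear mscale mscale "der_D d :: 'k mpol \<Rightarrow> 'k mpol" by (rule linear_D)
  have "der_D d (single \<mu> (1::'k)) \<in> supported (monos_ge d m 2)" if "\<mu> \<in> monos_ge d m 0" for \<mu>
  proof -
    have "single \<mu> (1::'k) \<in> supported (wmonos d m (wt d \<mu>))"
      using that by (auto simp: supported_def wmonos_def monos_ge_def)
    from D_supported[OF this] show ?thesis
      using supported_mono[OF wmonos_subset_monos_ge[of 2 "wt d \<mu> + 2" d m]] that
      by (auto simp: monos_ge_def)
  qed
  then have 1: "der_D d ` supported (monos_ge d m 0) \<subseteq> (supported (monos_ge d m 2) :: 'k mpol set)"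
    by (auto intro: linear_supported[OF linear_D])
  have "single \<mu> (1::'k) \<in> der_D d ` supported (monos_ge d m 0)" if "\<mu> \<in> monos_ge d m 2" for \<mu>
  proof -
    have "single \<mu> (1::'k) \<in> supported (wmonos d m (wt d \<mu>))" "wt d \<mu> \<ge> 2"
      using that by (auto simp: supported_def wmonos_def monos_ge_def)
    then show ?thesis
      using D_surjective[of "single \<mu> (1::'k)" d m "wt d \<mu>"]
        supported_mono[OF wmonos_subset_monos_ge[of 0 "wt d \<mu> - 2" d m]] by force
  qed
  then have "mpol.span ((\<lambda>\<mu>. single \<mu> 1) ` monos_ge d m 2) \<subseteq> (der_D d ` supported (monos_ge d m 0) :: 'k mpol set)"
    by (intro mpol.span_minimal D.subspace_image subspace_supported) auto
  then show ?thesis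
    using 1 by (simp add: span_singles)
qed

lemma finite_monos: "finite (monos_ge d m r)" "finite (wmonos d m w)"
  by (auto simp: monos_ge_def wmonos_def finite_monomials finite_vars)

text \<open>Semi-invariants have only nonnegative weights, and there \<open>der_D\<close> maps onto
  the weights at least 2; domain and image differ in size by the monomials of weight 0 and
  1.\<close>

lemma dim_semi_invariants:
  "mpol.dim (joint_semi_invariants d \<inter> homogeneous m :: 'k::field_char_0 mpol set) =
     card (wmonos d m 0) + card (wmonos d m 1)"
proof -
  have "joint_semi_invariants d \<inter> homogeneous m = {p \<in> supported (monos_ge d m 0) :: 'k mpol set. der_D d p = 0}"
  proof -
    have "p \<in> supported (monos_ge d m 0)" if "p \<in> joint_semi_invariants d \<inter> homogeneous m" for p :: "'k mpol"
      using that by (intro D_kernel_wt_nonneg)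
        (auto simp: joint_semi_invariants_def homogeneous_def supported_def poly_algebra_def monomials_def)
    then show ?thesis
      by (auto simp: joint_semi_invariants_def homogeneous_def supported_def poly_algebra_def monos_ge_def monomials_def)
  qed
  then have "mpol.dim (joint_semi_invariants d \<inter> homogeneous m :: 'k mpol set) + card (monos_ge d m 2) =
      card (monos_ge d m 0)"
    using kernel_dim[OF linear_D finite_monos(1) D_image_ge finite_monos(1), of d m] by simp
  moreover have disj: "(wmonos d m 0 \<union> wmonos d m 1) \<inter> monos_ge d m 2 = {}"
      "wmonos d m 0 \<inter> wmonos d m 1 = {}"
    by (auto simp: wmonos_def monos_ge_def)
  have "monos_ge d m 0 = (wmonos d m 0 \<union> wmonos d m 1) \<union> monos_ge d m 2"
    by (auto simp: monos_ge_def wmonos_def)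
  then have "card (monos_ge d m 0) = card (wmonos d m 0) + card (wmonos d m 1) + card (monos_ge d m 2)"
    using card_Un_disjoint[of "wmonos d m 0 \<union> wmonos d m 1" "monos_ge d m 2"]
      card_Un_disjoint[of "wmonos d m 0" "wmonos d m 1"] disj by (simp add: finite_monos)
  ultimately show ?thesis by simp
qed

text \<open>The commutator kills a joint invariant, which forces weight 0. In weight 0 the kernel of
  \<open>der_D\<close> already lies in that of \<open>der_Dstar\<close>, and \<open>der_D\<close>
  maps onto weight 2.\<close>

lemma dim_invariants:
  "mpol.dim (joint_invariants d \<inter> homogeneous m :: 'k::field_char_0 mpol set) + card (wmonos d m 2) =
     card (wmonos d m 0)"
proof -
  interpret D: Vector_Spaces.linear mscale mscale "der_D d :: 'k mpol \<Rightarrow> 'k mpol" by (rule linear_D)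
  interpret Ds: Vector_Spaces.linear mscale mscale "der_Dstar d :: 'k mpol \<Rightarrow> 'k mpol" by (rule linear_Dstar)
  have "joint_invariants d \<inter> homogeneous m = {p \<in> supported (wmonos d m 0) :: 'k mpol set. der_D d p = 0}"
  proof (intro set_eqI iffI)
    fix p :: "'k mpol" assume p: "p \<in> joint_invariants d \<inter> homogeneous m"
    then have "of_int (wt d \<mu>) * lookup p \<mu> = 0" for \<mu>
      using lookup_commutator[of p d \<mu>]
      by (auto simp: joint_invariants_def commutator_def D.zero Ds.zero)
    then have "wt d \<mu> = 0" if "\<mu> \<in> keys p" for \<mu>
      using that by (auto simp: in_keys_iff)
    then show "p \<in> {p \<in> supported (wmonos d m 0). der_D d p = 0}"
      using p by (auto simp: joint_invariants_def homogeneous_def supported_def poly_algebra_def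
          wmonos_def monomials_def)
  next
    fix p :: "'k mpol" assume "p \<in> {p \<in> supported (wmonos d m 0). der_D d p = 0}"
    then have p: "p \<in> supported (wmonos d m 0)" "der_D d p = 0" by auto
    \<comment> \<open>With \<open>w = 0\<close> the commutator relation shows that
      \<open>der_D\<close> kills \<open>der_Dstar d p\<close>, which has weight -2; injectivity on
      negative weights applies.\<close>
    have "der_Dstar d p = 0"
      using D_injective[OF Dstar_supported[OF p(1)]] D_Dstar[OF p(1)] p(2) by (simp add: Ds.zero)
    then show "p \<in> joint_invariants d \<inter> homogeneous m"
      using p by (auto simp: joint_invariants_def homogeneous_def supported_def poly_algebra_def
          wmonos_def monomials_def)
  qed
  moreover have "der_D d ` supported (wmonos d m 0) = (supported (wmonos d m 2) :: 'k mpol set)"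
    using D_supported[of _ d m 0] D_surjective[of _ d m 2] by fastforce
  ultimately show ?thesis
    using kernel_dim[OF linear_D finite_monos(2) _ finite_monos(2)] by simp
qed

section \<open>Partial fractions\<close>

text \<open>Equality is asked only off the poles, because the convention \<open>1 / 0 = 0\<close>
  breaks partial fraction identities at the poles.\<close>

definition pf_span :: "('i \<Rightarrow> complex) \<Rightarrow> 'i set \<Rightarrow> ('i \<Rightarrow> nat) \<Rightarrow> (complex \<Rightarrow> complex) set" where
  "pf_span a I \<beta> = {f. \<exists>B. \<forall>t. (\<forall>i\<in>I. a i * t \<noteq> 1) \<longrightarrow>
     f t = (\<Sum>i\<in>I. \<Sum>k=1..\<beta> i. B i k * (1 / (1 - a i * t)) ^ k)}"

lemma pf_span_cong:
  assumes "f \<in> pf_span a I \<beta>" "\<And>t. (\<And>i. i \<in> I \<Longrightarrow> a i * t \<noteq> 1) \<Longrightarrow> g t = f t"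
  shows "g \<in> pf_span a I \<beta>"
  using assms unfolding pf_span_def by fastforce

lemma pf_span_0: "(\<lambda>_. 0) \<in> pf_span a I \<beta>"
  unfolding pf_span_def by (auto intro!: exI[of _ "\<lambda>_ _. 0"])

lemma pf_span_add:
  assumes "f \<in> pf_span a I \<beta>" "g \<in> pf_span a I \<beta>"
  shows "(\<lambda>t. f t + g t) \<in> pf_span a I \<beta>"
proof -
  obtain B where B: "\<And>t. \<forall>i\<in>I. a i * t \<noteq> 1 \<Longrightarrow> f t = (\<Sum>i\<in>I. \<Sum>k=1..\<beta> i. B i k * (1 / (1 - a i * t)) ^ k)"
    using assms(1) unfolding pf_span_def by auto
  obtain C where C: "\<And>t. \<forall>i\<in>I. a i * t \<noteq> 1 \<Longrightarrow> g t = (\<Sum>i\<in>I. \<Sum>k=1..\<beta> i. C i k * (1 / (1 - a i * t)) ^ k)"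
    using assms(2) unfolding pf_span_def by auto
  show ?thesis
    unfolding pf_span_def mem_Collect_eq
    by (rule exI[of _ "\<lambda>i k. B i k + C i k"]) (simp add: B C distrib_right sum.distrib)
qed

lemma pf_span_cmult:
  assumes "f \<in> pf_span a I \<beta>"
  shows "(\<lambda>t. c * f t) \<in> pf_span a I \<beta>"
proof -
  obtain B where B: "\<And>t. \<forall>i\<in>I. a i * t \<noteq> 1 \<Longrightarrow> f t = (\<Sum>i\<in>I. \<Sum>k=1..\<beta> i. B i k * (1 / (1 - a i * t)) ^ k)"
    using assms(1) unfolding pf_span_def by auto
  show ?thesis
    unfolding pf_span_def mem_Collect_eq
    by (rule exI[of _ "\<lambda>i k. c * B i k"]) (simp add: B sum_distrib_left mult.assoc)
qed

lemma pf_span_sum: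
  "(\<And>x. x \<in> X \<Longrightarrow> f x \<in> pf_span a I \<beta>) \<Longrightarrow> (\<lambda>t. \<Sum>x\<in>X. f x t) \<in> pf_span a I \<beta>"
  by (induction X rule: infinite_finite_induct) (auto intro: pf_span_0 pf_span_add)

lemma pf_span_base:
  assumes "finite I" "i \<in> I" "1 \<le> k" "k \<le> \<beta> i"
  shows "(\<lambda>t. (1 / (1 - a i * t)) ^ k) \<in> pf_span a I \<beta>"
proof -
  have "(\<Sum>j\<in>I. \<Sum>l=1..\<beta> j. (if j = i \<and> l = k then 1 else 0) * (1 / (1 - a j * t)) ^ l) =
      (1 / (1 - a i * t)) ^ k" for t
  proof -
    have "(\<Sum>l=1..\<beta> j. (if j = i \<and> l = k then 1 else 0) * (1 / (1 - a j * t)) ^ l) =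
      (if j = i then (1 / (1 - a i * t)) ^ k else 0)" for j
      using assms by (auto simp: if_distribR sum.delta if_distrib cong: if_cong)
    then show ?thesis
      using assms by simp
  qed
  then show ?thesis
    unfolding pf_span_def mem_Collect_eq by (intro exI[of _ "\<lambda>j l. if j = i \<and> l = k then 1 else 0"]) auto
qed

text \<open>With \<open>u_i = 1 / (1 - a_i t)\<close>, the identity
  \<open>u_i u_j = (a_i u_i - a_j u_j) / (a_i - a_j)\<close> lowers \<open>p + q\<close> by one
  until one of the two poles has disappeared.\<close>

lemma pf_span_two:
  assumes "finite I" "i \<in> I" "j \<in> I" "a i \<noteq> a j" "p \<le> \<beta> i" "q \<le> \<beta> j" "p + q > 0"
  shows "(\<lambda>t. (1 / (1 - a i * t)) ^ p * (1 / (1 - a j * t)) ^ q) \<in> pf_span a I \<beta>"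
  using assms(5-7)
proof (induction "p + q" arbitrary: p q rule: less_induct)
  case less
  show ?case
  proof (cases "p = 0 \<or> q = 0")
    case True
    then show ?thesis
      using less.prems pf_span_base[of I i p \<beta> a] pf_span_base[of I j q \<beta> a] assms(1-3) by auto
  next
    case False
    then obtain p' q' where pq: "p = Suc p'" "q = Suc q'"
      by (meson not0_implies_Suc)
    let ?u = "\<lambda>i t. 1 / (1 - a i * t)"
    have "(\<lambda>t. (a i / (a i - a j)) * (?u i t ^ p * ?u j t ^ q') + (- a j / (a i - a j)) * (?u i t ^ p' * ?u j t ^ q))
      \<in> pf_span a I \<beta>"
      using less.prems pq by (intro pf_span_add pf_span_cmult less.hyps) auto
    then show ?thesis
    proof (rule pf_span_cong)
      fix t assume "\<And>i. i \<in> I \<Longrightarrow> a i * t \<noteq> 1"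
      then have "1 - a i * t \<noteq> 0" "1 - a j * t \<noteq> 0" "a i - a j \<noteq> 0"
        using assms(2,3,4) by auto
      then have "?u i t * ?u j t = (a i / (a i - a j)) * ?u i t + (- a j / (a i - a j)) * ?u j t"
        by (simp add: divide_simps) (simp add: algebra_simps)
      then have "(?u i t ^ p' * ?u j t ^ q') * (?u i t * ?u j t) =
        (?u i t ^ p' * ?u j t ^ q') * ((a i / (a i - a j)) * ?u i t + (- a j / (a i - a j)) * ?u j t)"
        by simp
      then show "?u i t ^ p * ?u j t ^ q =
          (a i / (a i - a j)) * (?u i t ^ p * ?u j t ^ q') + (- a j / (a i - a j)) * (?u i t ^ p' * ?u j t ^ q)"
        unfolding pq power_Suc by (simp only: distrib_left mult_ac)
    qed
  qed
qed

text \<open>Induction on the set of poles: the new factor multiplies every term of the previous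
  decomposition, and each product of two pole terms is split again. If all exponents were 0, the
  product would be 1 but the sum empty.\<close>

lemma partial_fractions_exist:
  assumes "finite I" "inj_on a I" "\<exists>i\<in>I. \<beta> i > 0"
  shows "(\<lambda>t. \<Prod>i\<in>I. (1 / (1 - a i * t)) ^ \<beta> i) \<in> pf_span a I \<beta>"
  using assms
proof (induction I rule: finite_induct)
  case (insert j J)
  let ?u = "\<lambda>i t. 1 / (1 - a i * t)"
  show ?case
  proof (cases "\<exists>i\<in>J. \<beta> i > 0")
    case False
    then have "(\<Prod>i\<in>insert j J. ?u i t ^ \<beta> i) = ?u j t ^ \<beta> j" for t
      using insert.hyps by simp
    then show ?thesis
      using False insert.prems insert.hyps pf_span_base[of "insert j J" j "\<beta> j" \<beta> a] by auto
  next
    case True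
    then have "(\<lambda>t. \<Prod>i\<in>J. ?u i t ^ \<beta> i) \<in> pf_span a J \<beta>"
      using insert by auto
    then obtain B where B: "\<And>t. \<forall>i\<in>J. a i * t \<noteq> 1 \<Longrightarrow>
        (\<Prod>i\<in>J. ?u i t ^ \<beta> i) = (\<Sum>i\<in>J. \<Sum>k=1..\<beta> i. B i k * ?u i t ^ k)"
      unfolding pf_span_def by auto
    have "(\<lambda>t. \<Sum>i\<in>J. \<Sum>k=1..\<beta> i. B i k * (?u i t ^ k * ?u j t ^ \<beta> j)) \<in> pf_span a (insert j J) \<beta>"
      using insert.prems insert.hyps
      by (intro pf_span_sum pf_span_cmult pf_span_two) (auto simp: inj_on_def)
    then show ?thesis
    proof (rule pf_span_cong)
      fix t assume t: "\<And>i. i \<in> insert j J \<Longrightarrow> a i * t \<noteq> 1"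
      have "(\<Prod>i\<in>insert j J. ?u i t ^ \<beta> i) = (\<Sum>i\<in>J. \<Sum>k=1..\<beta> i. B i k * ?u i t ^ k) * ?u j t ^ \<beta> j"
        using insert.hyps B t by (simp add: mult.commute)
      then show "(\<Prod>i\<in>insert j J. ?u i t ^ \<beta> i) = (\<Sum>i\<in>J. \<Sum>k=1..\<beta> i. B i k * (?u i t ^ k * ?u j t ^ \<beta> j))"
        by (simp add: sum_distrib_right mult.assoc)
    qed
  qed
qed simp

text \<open>A Laurent expansion depends only on a punctured neighbourhood, so an identity that may
  fail at the centre still determines the series.\<close>

lemma has_fps_expansion_unique_punctured:
  fixes f g :: "complex \<Rightarrow> complex"
  assumes "f has_fps_expansion F" "g has_fps_expansion G" "\<forall>\<^sub>F x in at 0. f x = g x"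
  shows "F = G"
proof -
  have "f has_laurent_expansion fps_to_fls F" "g has_laurent_expansion fps_to_fls G"
    using assms(1,2) by (simp_all add: has_fps_expansion_to_laurent)
  then have "fps_to_fls F = fps_to_fls G"
    using assms(3) has_laurent_expansion_cong has_laurent_expansion_unique by blast
  then show ?thesis by simp
qed

lemma has_fps_expansion_linear_inverse:
  fixes p q :: complex
  assumes "p \<noteq> 0"
  shows "(\<lambda>w. 1 / (p + q * w)) has_fps_expansion inverse (fps_const p + fps_const q * fps_X)"
proof -
  have "(\<lambda>w. inverse (p + q * w)) has_fps_expansion inverse (fps_const p + fps_const q * fps_X)"
    using assms by (intro fps_expansion_intros) auto
  then show ?thesis by (simp add: inverse_eq_divide)
qed

text \<open>The substitution \<open>t = (1 + w) / a_i\<close> moves the pole to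
  \<open>w = 0\<close>, where \<open>1 - a_i t = - w\<close>. After multiplication by
  \<open>(- w)^(\<beta> i)\<close> pole \<open>i\<close> contributes the terms
  \<open>B i k (- w)^(\<beta> i - k)\<close>, while the other poles contribute only from order
  \<open>\<beta> i\<close> on.\<close>

lemma partial_fractions_coeff:
  fixes a :: "'i \<Rightarrow> complex" and E :: "'i \<Rightarrow> complex fps"
  assumes fin: "finite I" and i: "i \<in> I" and nz: "a i \<noteq> 0"
    and B: "\<And>t. \<forall>i\<in>I. a i * t \<noteq> 1 \<Longrightarrow>
      (\<Prod>i\<in>I. (1 / (1 - a i * t)) ^ \<beta> i) = (\<Sum>i\<in>I. \<Sum>k=1..\<beta> i. B i k * (1 / (1 - a i * t)) ^ k)"
    and E: "\<And>j. j \<in> I - {i} \<Longrightarrow> (\<lambda>w. 1 / (1 - a j / a i * (1 + w))) has_fps_expansion E j"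
    and k: "1 \<le> k" "k \<le> \<beta> i"
  shows "B i k = (-1) ^ (\<beta> i - k) * fps_nth (\<Prod>j\<in>I-{i}. E j ^ \<beta> j) (\<beta> i - k)"
proof -
  let ?u = "\<lambda>j t. 1 / (1 - a j * t)"
  let ?v = "\<lambda>j w. 1 / (1 - a j / a i * (1 + w))"
  let ?R = "\<Sum>j\<in>I-{i}. \<Sum>k=1..\<beta> j. fps_const (B j k) * E j ^ k"
  let ?L = "\<Sum>k=1..\<beta> i. fps_const (B i k) * (- fps_X) ^ (\<beta> i - k)"
  have 1: "(\<lambda>w. \<Prod>j\<in>I-{i}. ?v j w ^ \<beta> j) has_fps_expansion (\<Prod>j\<in>I-{i}. E j ^ \<beta> j)"
    by (intro fps_expansion_intros E)
  have 2: "(\<lambda>w. (\<Sum>k=1..\<beta> i. B i k * (- w) ^ (\<beta> i - k)) +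
      (- w) ^ \<beta> i * (\<Sum>j\<in>I-{i}. \<Sum>k=1..\<beta> j. B j k * ?v j w ^ k)) has_fps_expansion
      ?L + (- fps_X) ^ \<beta> i * ?R"
    by (intro fps_expansion_intros E)
  have ev: "\<forall>\<^sub>F w in at 0. \<forall>j\<in>I. a j / a i * (1 + w) \<noteq> 1"
  proof (rule eventually_ball_finite[OF fin], rule ballI)
    fix j assume j: "j \<in> I"
    show "\<forall>\<^sub>F w in at 0. a j / a i * (1 + w) \<noteq> 1"
    proof (cases "a j = 0")
      case False
      have "\<forall>\<^sub>F w in at 0. w \<noteq> a i / a j - 1"
        by (rule eventually_neq_at_within)
      then show ?thesis
        using False nz by (auto elim!: eventually_mono simp: field_simps)
    qed simp
  qed
  have "\<forall>\<^sub>F w in at 0. (\<Prod>j\<in>I-{i}. ?v j w ^ \<beta> j) = (\<Sum>k=1..\<beta> i. B i k * (- w) ^ (\<beta> i - k)) +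
      (- w) ^ \<beta> i * (\<Sum>j\<in>I-{i}. \<Sum>k=1..\<beta> j. B j k * ?v j w ^ k)"
    using ev eventually_neq_at_within[of 0]
  proof eventually_elim
    case (elim w)
    have u: "?u j ((1 + w) / a i) = ?v j w" for j
      by simp
    have ui: "?v i w = 1 / (- w)"
      using nz by simp
    have "(1 / (- w)) ^ \<beta> i * (\<Prod>j\<in>I-{i}. ?v j w ^ \<beta> j) = (\<Prod>j\<in>I. ?v j w ^ \<beta> j)"
      using fin i by (simp add: prod.remove[of I i] nz)
    also have "\<dots> = (\<Sum>j\<in>I. \<Sum>k=1..\<beta> j. B j k * ?v j w ^ k)"
      using B[of "(1 + w) / a i"] elim unfolding u by simp
    also have "\<dots> = (\<Sum>k=1..\<beta> i. B i k * (1 / (- w)) ^ k) + (\<Sum>j\<in>I-{i}. \<Sum>k=1..\<beta> j. B j k * ?v j w ^ k)"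
      using fin i nz by (simp add: sum.remove[of I i])
    finally have "(- w) ^ \<beta> i * ((1 / (- w)) ^ \<beta> i * (\<Prod>j\<in>I-{i}. ?v j w ^ \<beta> j)) =
       (- w) ^ \<beta> i * ((\<Sum>k=1..\<beta> i. B i k * (1 / (- w)) ^ k) + (\<Sum>j\<in>I-{i}. \<Sum>k=1..\<beta> j. B j k * ?v j w ^ k))"
      by simp
    moreover have "(- w) ^ \<beta> i * (1 / (- w)) ^ \<beta> i = 1"
      using elim by (simp add: flip: power_mult_distrib)
    moreover have "(- w) ^ \<beta> i * (\<Sum>k=1..\<beta> i. B i k * (1 / (- w)) ^ k) = (\<Sum>k=1..\<beta> i. B i k * (- w) ^ (\<beta> i - k))"
      unfolding sum_distrib_left
    proof (rule sum.cong[OF refl])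
      fix k assume "k \<in> {1..\<beta> i}"
      then have "(- w) ^ \<beta> i = (- w) ^ (\<beta> i - k) * (- w) ^ k"
        by (simp flip: power_add)
      moreover have "(- w) ^ k * (1 / (- w)) ^ k = 1"
        using elim by (simp flip: power_mult_distrib)
      ultimately show "(- w) ^ \<beta> i * (B i k * (1 / (- w)) ^ k) = B i k * (- w) ^ (\<beta> i - k)"
        by (metis mult.assoc mult.commute mult.right_neutral)
    qed
    ultimately show ?case
      by (simp add: distrib_left mult.assoc[symmetric])
  qed
  then have eq: "(\<Prod>j\<in>I-{i}. E j ^ \<beta> j) = ?L + (- fps_X) ^ \<beta> i * ?R"
    by (rule has_fps_expansion_unique_punctured[OF 1 2])
  have X: "(- fps_X) ^ n = fps_const ((-1) ^ n) * (fps_X ^ n :: complex fps)" for n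
    by (simp add: power_minus[of fps_X] flip: fps_const_power fps_const_neg)
  \<comment> \<open>Since \<open>k >= 1\<close>, the index \<open>\<beta> i - k\<close> lies below
    the order of the power of \<open>fps_X\<close>.\<close>
  have "fps_nth ((- fps_X) ^ \<beta> i * ?R) (\<beta> i - k) = 0"
    using k unfolding X mult.assoc fps_mult_left_const_nth by (simp add: fps_X_power_mult_nth)
  moreover have "fps_nth ?L (\<beta> i - k) = (\<Sum>l=1..\<beta> i. if l = k then (-1) ^ (\<beta> i - k) * B i k else 0)"
    unfolding fps_sum_nth X using k by (intro sum.cong) auto
  then have "fps_nth ?L (\<beta> i - k) = (-1) ^ (\<beta> i - k) * B i k"
    using k by simp
  ultimately have "fps_nth (\<Prod>j\<in>I-{i}. E j ^ \<beta> j) (\<beta> i - k) = (-1) ^ (\<beta> i - k) * B i k"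
    by (simp add: eq)
  then show ?thesis
    by (simp flip: mult.assoc power_mult_distrib)
qed

section \<open>The coefficients of the partial fraction decomposition\<close>

lemma fps_nth_linear_inverse:
  fixes p q :: "'a::field"
  assumes "p \<noteq> 0"
  shows "fps_nth (inverse (fps_const p + fps_const q * fps_X)) n = (- q) ^ n / p ^ Suc n"
proof -
  have "Abs_fps (\<lambda>n. (- q) ^ n / p ^ Suc n) * (fps_const p + fps_const q * fps_X) = 1" (is "?F * ?G = 1")
  proof (rule fps_ext)
    fix n
    have "?F * ?G = ?F * fps_const p + fps_const q * (?F * fps_X)"
      by (simp only: distrib_left distrib_right mult_ac)
    then have "fps_nth (?F * ?G) n = fps_nth ?F n * p + q * fps_nth (?F * fps_X) n"
      by (simp only: fps_add_nth fps_mult_right_const_nth fps_mult_left_const_nth)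
    then show "fps_nth (?F * ?G) n = fps_nth 1 n"
      using assms by (cases n) (simp_all add: divide_simps)
  qed
  then have "inverse ?G = ?F"
    using assms by (metis fps_inverse_unique mult.commute)
  then show ?thesis by simp
qed

text \<open>The parameter \<open>z\<close> varies analytically while the series variable stays
  formal.\<close>

definition coeffs_holo :: "(complex \<Rightarrow> complex fps) \<Rightarrow> complex set \<Rightarrow> bool" where
  "coeffs_holo G S \<longleftrightarrow> (\<forall>n. (\<lambda>z. fps_nth (G z) n) holomorphic_on S)"

lemma coeffs_holo_mult: "coeffs_holo F S \<Longrightarrow> coeffs_holo G S \<Longrightarrow> coeffs_holo (\<lambda>z. F z * G z) S"
  unfolding coeffs_holo_def fps_mult_nth by (auto intro!: holomorphic_intros)

lemma coeffs_holo_const: "coeffs_holo (\<lambda>_. F) S"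
  by (simp add: coeffs_holo_def)

lemma coeffs_holo_power: "coeffs_holo F S \<Longrightarrow> coeffs_holo (\<lambda>z. F z ^ n) S"
  by (induction n) (auto intro: coeffs_holo_mult coeffs_holo_const)

lemma coeffs_holo_prod: "(\<And>x. x \<in> X \<Longrightarrow> coeffs_holo (F x) S) \<Longrightarrow> coeffs_holo (\<lambda>z. \<Prod>x\<in>X. F x z) S"
  by (induction X rule: infinite_finite_induct) (auto intro: coeffs_holo_mult coeffs_holo_const)

text \<open>The expansion of \<open>1 / (1 - t z^j)\<close> around the pole \<open>t = z^(-i)\<close> in the variable \<open>w\<close> with
  \<open>t = z^(-i) (1 + w)\<close>. For \<open>j < i\<close> it is rewritten so that only nonnegative powers of \<open>z\<close> occur, which
  makes its coefficients holomorphic at \<open>z = 0\<close>.\<close>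

definition pole_factor :: "nat \<Rightarrow> nat \<Rightarrow> complex \<Rightarrow> complex fps" where
  "pole_factor i j z =
     (if i < j then inverse (fps_const (1 - z ^ (j - i)) + fps_const (- (z ^ (j - i))) * fps_X)
      else fps_const (- (z ^ (i - j))) * inverse (fps_const (1 - z ^ (i - j)) + fps_const 1 * fps_X))"

lemma power_neq_1:
  fixes z :: complex
  assumes "norm z < 1" "n > 0"
  shows "z ^ n \<noteq> 1"
proof
  assume "z ^ n = 1"
  then have "norm z ^ n = 1"
    by (metis norm_one norm_power)
  then show False
    using assms power_less_one_iff[of "norm z" n] by simp
qed

text \<open>By the geometric series the denominators are powers of \<open>1 - z^n\<close> with
  \<open>n = |i - j| > 0\<close>, which have no zero in the unit disc.\<close>

lemma pole_factor_coeffs_holo: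
  assumes "i \<noteq> j"
  shows "coeffs_holo (pole_factor i j) (ball 0 1)"
proof (cases "i < j")
  case True
  have "(\<lambda>z. fps_nth (pole_factor i j z) n) holomorphic_on ball 0 1" for n
  proof (rule holomorphic_transform)
    show "(\<lambda>z::complex. (z ^ (j - i)) ^ n / (1 - z ^ (j - i)) ^ Suc n) holomorphic_on ball 0 1"
      using True by (intro holomorphic_intros) (auto simp: power_neq_1)
    show "(z ^ (j - i)) ^ n / (1 - z ^ (j - i)) ^ Suc n = fps_nth (pole_factor i j z) n" if "z \<in> ball 0 1" for z
      using that True power_neq_1[of z "j - i"]
      unfolding pole_factor_def by (simp add: fps_nth_linear_inverse)
  qed
  then show ?thesis by (simp add: coeffs_holo_def)
next
  case False
  then have ij: "j < i" using assms by simp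
  have "(\<lambda>z. fps_nth (pole_factor i j z) n) holomorphic_on ball 0 1" for n
  proof (rule holomorphic_transform)
    show "(\<lambda>z::complex. - (z ^ (i - j)) * ((-1) ^ n / (1 - z ^ (i - j)) ^ Suc n)) holomorphic_on ball 0 1"
      using ij by (intro holomorphic_intros) (auto simp: power_neq_1)
    show "- (z ^ (i - j)) * ((-1) ^ n / (1 - z ^ (i - j)) ^ Suc n) = fps_nth (pole_factor i j z) n" if "z \<in> ball 0 1" for z
      using that ij power_neq_1[of z "i - j"] fps_nth_linear_inverse[of "1 - z ^ (i - j)" 1 n]
      unfolding pole_factor_def by simp
  qed
  then show ?thesis by (simp add: coeffs_holo_def)
qed

lemma pole_factor_expansion:
  assumes "i \<noteq> j" "z \<noteq> 0" "norm z < 1"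
  shows "(\<lambda>w. 1 / (1 - z ^ j / z ^ i * (1 + w))) has_fps_expansion pole_factor i j z"
proof (cases "i < j")
  case True
  then have c: "z ^ j / z ^ i = z ^ (j - i)"
    using assms by (simp add: power_diff)
  have "(\<lambda>w. 1 / ((1 - z ^ (j - i)) + (- (z ^ (j - i))) * w)) has_fps_expansion pole_factor i j z"
    using True assms power_neq_1[of z "j - i"] unfolding pole_factor_def
    by (simp only: if_True) (intro has_fps_expansion_linear_inverse, auto)
  then show ?thesis
    unfolding c by (simp add: algebra_simps)
next
  case False
  then have ij: "j < i" using assms by simp
  have "(\<lambda>w. - (z ^ (i - j)) * (1 / ((1 - z ^ (i - j)) + 1 * w))) has_fps_expansion pole_factor i j z"
    using False ij assms power_neq_1[of z "i - j"] unfolding pole_factor_def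
    by (simp only: if_False) (intro fps_expansion_intros has_fps_expansion_linear_inverse, auto)
  moreover have "1 / (1 - z ^ j / z ^ i * (1 + w)) = - (z ^ (i - j)) * (1 / ((1 - z ^ (i - j)) + 1 * w))" for w
  proof -
    \<comment> \<open>In terms of \<open>e\<close> the claim is
      \<open>1 / (1 - (1 + w) / e) = - e / ((1 - e) + w)\<close>.\<close>
    define e where "e = z ^ (i - j)"
    have e: "e \<noteq> 0" "z ^ j / z ^ i = 1 / e"
      using assms ij by (auto simp: e_def power_diff)
    have "1 - 1 / e * (1 + w) = - ((1 - e) + w) / e"
      using e by (simp add: field_simps)
    then show ?thesis
      unfolding e(2) e_def[symmetric] by (simp only: minus_divide_left[symmetric] mult_1 mult_1_right
          divide_minus_right divide_divide_eq_right times_divide_eq_right minus_mult_left[symmetric])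
  qed
  ultimately show ?thesis by simp
qed

text \<open>The coefficient of \<open>1 / (1 - t z^i)^k\<close> in a form that, unlike
  \<open>A_val\<close>, is regular at \<open>z = 0\<close>.\<close>

definition pf_coeff :: "nat \<Rightarrow> (nat \<Rightarrow> nat) \<Rightarrow> nat \<Rightarrow> nat \<Rightarrow> complex \<Rightarrow> complex" where
  "pf_coeff N \<beta> i k z = (-1) ^ (\<beta> i - k) * fps_nth (\<Prod>j\<in>{..N}-{i}. pole_factor i j z ^ \<beta> j) (\<beta> i - k)"

lemma pf_coeff_holomorphic: "pf_coeff N \<beta> i k holomorphic_on ball 0 1"
proof -
  have "coeffs_holo (\<lambda>z. \<Prod>j\<in>{..N}-{i}. pole_factor i j z ^ \<beta> j) (ball 0 1)"
    by (intro coeffs_holo_prod coeffs_holo_power pole_factor_coeffs_holo) auto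
  then show ?thesis
    unfolding coeffs_holo_def pf_coeff_def by (auto intro!: holomorphic_intros)
qed

text \<open>The pole factor for \<open>j = 0\<close> carries \<open>z^i\<close>, which vanishes at
  \<open>z = 0\<close>.\<close>

lemma pf_coeff_0:
  assumes "0 < i" "0 < \<beta> 0"
  shows "pf_coeff N \<beta> i k 0 = 0"
proof -
  have "pole_factor i 0 0 = 0"
    using assms by (simp add: pole_factor_def)
  then have "(\<Prod>j\<in>{..N}-{i}. pole_factor i j 0 ^ \<beta> j) = 0"
    using assms by (intro prod_zero bexI[of _ 0]) auto
  then show ?thesis unfolding pf_coeff_def by (simp only: fps_zero_nth mult_zero_right)
qed

lemma inj_on_powers:
  fixes z :: complex
  assumes "z \<noteq> 0" "norm z < 1"
  shows "inj (\<lambda>i. z ^ i)"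
proof (rule injI)
  fix i j assume "z ^ i = z ^ j"
  then have "norm z ^ i = norm z ^ j"
    by (metis norm_power)
  then show "i = j"
    using assms power_strict_decreasing[of i j "norm z"] power_strict_decreasing[of j i "norm z"]
    by (cases i j rule: linorder_cases) auto
qed

lemma partial_fractions_powers:
  fixes z :: complex
  assumes z: "z \<noteq> 0" "norm z < 1" and "0 < \<beta> 0" and t: "\<forall>i\<le>N. z ^ i * t \<noteq> 1"
  shows "(\<Prod>i\<le>N. (1 / (1 - z ^ i * t)) ^ \<beta> i) = (\<Sum>i\<le>N. \<Sum>k=1..\<beta> i. pf_coeff N \<beta> i k z * (1 / (1 - z ^ i * t)) ^ k)"
proof -
  have "(\<lambda>t. \<Prod>i\<le>N. (1 / (1 - z ^ i * t)) ^ \<beta> i) \<in> pf_span (\<lambda>i. z ^ i) {..N} \<beta>"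
    using assms inj_on_powers[OF z] by (intro partial_fractions_exist) (auto intro: inj_on_subset)
  then obtain B where B: "\<And>t. \<forall>i\<in>{..N}. z ^ i * t \<noteq> 1 \<Longrightarrow>
      (\<Prod>i\<le>N. (1 / (1 - z ^ i * t)) ^ \<beta> i) = (\<Sum>i\<le>N. \<Sum>k=1..\<beta> i. B i k * (1 / (1 - z ^ i * t)) ^ k)"
    unfolding pf_span_def by auto
  have "B i k = pf_coeff N \<beta> i k z" if "i \<le> N" "k \<in> {1..\<beta> i}" for i k
    unfolding pf_coeff_def
    by (rule partial_fractions_coeff[where a = "\<lambda>i. z ^ i"])
      (use that z B pole_factor_expansion[OF _ z] in auto)
  then show ?thesis
    using B t by simp
qed

text \<open>The power of \<open>1 - t z^i\<close> cancels the pole at \<open>t0 = z^(-i)\<close> and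
  leaves \<open>?g\<close>, holomorphic there, so the limit is a derivative of \<open>?g\<close>.
  Under \<open>t = t0 (1 + w)\<close> it becomes a Taylor coefficient times
  \<open>n! / t0^n\<close>, and \<open>t0^n\<close> cancels against \<open>(z^i)^n\<close> in the
  prefactor.\<close>

lemma A_val_eq:
  assumes \<beta>: "is_beta d \<beta>" and z: "z \<noteq> 0" "norm z < 1" and i: "i \<le> 2 * dmax d"
  shows "A_val d \<beta> i k z = pf_coeff (2 * dmax d) \<beta> i k z"
proof -
  define N where "N = 2 * dmax d"
  define t0 where "t0 = z powi (- int i)"
  define n where "n = \<beta> i - k"
  have t0: "t0 * z ^ i = 1" "t0 \<noteq> 0"
    using z by (simp_all add: t0_def power_int_minus)
  let ?f = "\<lambda>t. f_gen d (t * z ^ dmax d) z * (1 - t * z ^ i) ^ \<beta> i"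
  let ?g = "\<lambda>t. \<Prod>j\<in>{..N}-{i}. (1 / (1 - t * z ^ j)) ^ \<beta> j"
  define S where "S = {t. \<forall>j\<in>{..N}-{i}. 1 - t * z ^ j \<noteq> 0}"
  have "S = (\<Inter>j\<in>{..N}-{i}. {t. 1 - t * z ^ j \<noteq> 0})"
    by (auto simp: S_def)
  then have S_open: "open S"
    by (auto intro!: open_INT open_Collect_neq continuous_intros)
  have g_holo: "?g holomorphic_on S"
    by (intro holomorphic_intros) (auto simp: S_def)
  have t0_S: "t0 \<in> S"
  proof -
    have "1 - t0 * z ^ j \<noteq> 0" if "j \<noteq> i" for j
    proof
      assume "1 - t0 * z ^ j = 0"
      then have "t0 * z ^ j = t0 * z ^ i" using t0 by simp
      then have "z ^ j = z ^ i" using t0(2) mult_left_cancel by blast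
      then show False using that inj_on_powers[OF z] by (auto simp: inj_def)
    qed
    then show ?thesis by (auto simp: S_def)
  qed
  \<comment> \<open>At \<open>t0\<close> itself the values may differ, because
    \<open>1 / 0 = 0\<close> enters \<open>f_gen\<close>.\<close>
  have fg: "?f t = ?g t" if "t \<noteq> t0" for t
  proof -
    have "1 - t * z ^ i \<noteq> 0"
    proof
      assume "1 - t * z ^ i = 0"
      then have "t * z ^ i = t0 * z ^ i" using t0 by simp
      then show False using that z by simp
    qed
    moreover have "f_gen d (t * z ^ dmax d) z = (1 / (1 - t * z ^ i)) ^ \<beta> i * ?g t"
      using \<beta> z i unfolding is_beta_def N_def by (simp add: prod.remove[of "{..2 * dmax d}" i])
    ultimately show ?thesis
      by (simp add: power_one_over)
  qed
  have "(deriv ^^ n) ?f t = (deriv ^^ n) ?g t" if "t \<in> S - {t0}" for t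
  proof (rule higher_deriv_cong_ev)
    have "\<forall>\<^sub>F x in nhds t. x \<in> S - {t0}"
      using that S_open by (intro eventually_nhds_in_open) auto
    then show "\<forall>\<^sub>F x in nhds t. ?f x = ?g x"
      by (rule eventually_mono) (use fg in blast)
  qed simp
  moreover have "\<forall>\<^sub>F t in at t0. t \<in> S - {t0}"
    using S_open t0_S by (rule eventually_at_in_open)
  ultimately have ev: "\<forall>\<^sub>F t in at t0. (deriv ^^ n) ?f t = (deriv ^^ n) ?g t"
    by (auto elim: eventually_mono)
  have "(deriv ^^ n) ?g holomorphic_on S"
    using g_holo S_open by (rule holomorphic_higher_deriv)
  then have "isCont ((deriv ^^ n) ?g) t0"
    using S_open t0_S continuous_on_eq_continuous_at holomorphic_on_imp_continuous_on by blast
  then have "((deriv ^^ n) ?f \<longlongrightarrow> (deriv ^^ n) ?g t0) (at t0)"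
    using ev by (simp add: isCont_def tendsto_cong)
  then have Lim: "Lim (at t0) ((deriv ^^ n) ?f) = (deriv ^^ n) ?g t0"
    by (intro tendsto_Lim) auto
  have shift: "(deriv ^^ n) (\<lambda>w. ?g (t0 * w + t0)) 0 = t0 ^ n * (deriv ^^ n) ?g (t0 * 0 + t0)"
  proof (rule higher_deriv_compose_linear'[OF g_holo _ S_open])
    show "open ((\<lambda>w. t0 * w + t0) -` S)"
      by (intro open_vimage S_open continuous_intros)
  qed (use t0_S in auto)
  have "(\<lambda>w. \<Prod>j\<in>{..N}-{i}. (1 / (1 - z ^ j / z ^ i * (1 + w))) ^ \<beta> j) has_fps_expansion
      (\<Prod>j\<in>{..N}-{i}. pole_factor i j z ^ \<beta> j)"
    using z by (intro fps_expansion_intros pole_factor_expansion) auto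
  moreover have "z ^ j / z ^ i * (1 + w) = (t0 * w + t0) * z ^ j" for j w
  proof -
    have "1 / z ^ i = t0" using t0 z by (simp add: field_simps)
    then have "z ^ j / z ^ i = z ^ j * t0" by (metis times_divide_eq_right mult.right_neutral)
    then show ?thesis by (simp add: algebra_simps)
  qed
  ultimately have "(\<lambda>w. ?g (t0 * w + t0)) has_fps_expansion (\<Prod>j\<in>{..N}-{i}. pole_factor i j z ^ \<beta> j)"
    by simp
  then have "fps_nth (\<Prod>j\<in>{..N}-{i}. pole_factor i j z ^ \<beta> j) n = t0 ^ n * (deriv ^^ n) ?g t0 / fact n"
    using fps_nth_fps_expansion shift by fastforce
  moreover have "t0 ^ n * (z ^ i) ^ n = 1"
    using t0 by (simp flip: power_mult_distrib)
  then have "t0 ^ n = 1 / (z ^ i) ^ n"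
    using z by (simp add: field_simps)
  ultimately show ?thesis
    unfolding A_val_def pf_coeff_def
    using Lim by (simp flip: n_def t0_def N_def)
qed

text \<open>On the punctured unit disc \<open>A_val\<close> equals the holomorphic
  \<open>pf_coeff\<close>, so \<open>remove_sings\<close> fills in exactly its value at 0.\<close>

lemma A_fps_expansion:
  assumes "is_beta d \<beta>" "i \<le> 2 * dmax d"
  shows "pf_coeff (2 * dmax d) \<beta> i k has_fps_expansion A_fps d \<beta> i k"
proof -
  let ?H = "pf_coeff (2 * dmax d) \<beta> i k"
  have ana: "?H analytic_on {0}"
    using pf_coeff_holomorphic by (metis analytic_at centre_in_ball open_ball zero_less_one)
  have eq: "A_val d \<beta> i k w = ?H w" if "w \<in> ball 0 1 - {0}" for w
    using that A_val_eq[OF assms(1) _ _ assms(2)] by auto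
  have "remove_sings (A_val d \<beta> i k) w = ?H w" if w: "w \<in> ball 0 1" for w
  proof -
    have "\<forall>\<^sub>F x in at w. x \<in> ball 0 1 - {0}"
      using eventually_at_in_open'[OF open_ball w] eventually_neq_at_within[of 0]
      by eventually_elim simp
    then have "remove_sings (A_val d \<beta> i k) w = remove_sings ?H w"
      by (intro remove_sings_cong) (auto elim: eventually_mono simp: eq)
    also have "\<dots> = ?H w"
      using pf_coeff_holomorphic w by (metis analytic_at open_ball remove_sings_at_analytic)
    finally show ?thesis .
  qed
  then have "\<forall>\<^sub>F w in nhds 0. remove_sings (A_val d \<beta> i k) w = ?H w"
    using eventually_nhds_in_open[of "ball 0 1" 0] by (auto elim: eventually_mono)
  then have "A_fps d \<beta> i k = fps_expansion ?H 0"
    unfolding A_fps_def by (rule fps_expansion_cong)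
  then show ?thesis
    using analytic_at_imp_has_fps_expansion_0[OF ana] by simp
qed

text \<open>An index \<open>k\<close> with maximal \<open>d ! k\<close> contributes the factor
  \<open>1 / (1 - t)\<close> at \<open>j = d ! k\<close>. At \<open>t = 1\<close> this is
  \<open>1 / 0 = 0\<close>, so some factor with positive exponent \<open>\<beta> i\<close> vanishes
  too; as \<open>norm z < 1\<close>, it can only be the one for \<open>i = 0\<close>.\<close>

lemma is_beta_0_pos:
  assumes \<beta>: "is_beta d \<beta>" and d: "d \<noteq> []" 
  shows "\<beta> 0 > 0"
proof (rule ccontr)
  assume "\<not> \<beta> 0 > 0"
  then have "\<beta> 0 = 0" by simp
  define z :: complex where "z = 1 / 2"
  have z: "z \<noteq> 0" "norm z < 1" by (simp_all add: z_def)
  obtain k where k: "k < length d" "d ! k = dmax d"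
    using Max_in[of "set d"] d by (auto simp: in_set_conv_nth)
  have "1 - 1 * z ^ dmax d * z powi (int (d ! k) - 2 * int (d ! k)) = 0"
    using z k by (simp add: power_int_minus)
  then have "(\<Prod>j\<le>d ! k. 1 / (1 - 1 * z ^ dmax d * z powi (int (d ! k) - 2 * int j))) = 0"
    by (intro prod_zero bexI[of _ "d ! k"]) simp_all
  then have "f_gen d (1 * z ^ dmax d) z = 0"
    unfolding f_gen_def using k by (intro prod_zero) (simp, rule bexI[of _ k], simp_all)
  then have "(\<Prod>i\<le>2 * dmax d. (1 / (1 - 1 * z ^ i)) ^ \<beta> i) = 0"
    using \<beta> z unfolding is_beta_def by metis
  then obtain i where "(1 / (1 - z ^ i)) ^ \<beta> i = 0"
    by auto
  then have "i = 0" "\<beta> i > 0"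
    using power_neq_1[OF z(2), of i] by (auto intro: Nat.gr0I)
  then show False using \<open>\<beta> 0 = 0\<close> by simp
qed

section \<open>Comparison of coefficients\<close>

text \<open>The generating function of the complete homogeneous symmetric polynomials in the
  \<open>c v\<close>. Splitting monomials by divisibility by \<open>v\<close> shows that the factor
  \<open>1 - c_v X\<close> removes \<open>v\<close> from the variable set.\<close>

lemma complete_homogeneous_series:
  fixes c :: "var \<Rightarrow> complex"
  assumes "finite V"
  shows "(\<Prod>v\<in>V. inverse (1 - fps_const (c v) * fps_X)) =
    Abs_fps (\<lambda>m. \<Sum>\<mu>\<in>monomials V m. \<Prod>v\<in>V. c v ^ lookup \<mu> v)"
  using assms
proof (induction V rule: finite_induct)
  case empty
  show ?case
  proof (rule fps_ext)
    fix m show "fps_nth (\<Prod>v\<in>{}. inverse (1 - fps_const (c v) * fps_X)) m =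
        fps_nth (Abs_fps (\<lambda>m. \<Sum>\<mu>\<in>monomials {} m. \<Prod>v\<in>{}. c v ^ lookup \<mu> v)) m"
      by (cases m) (simp_all add: monomials_0 monomials_empty)
  qed
next
  case (insert v V)
  let ?p = "\<lambda>V \<mu>. \<Prod>v\<in>V. c v ^ lookup \<mu> v"
  let ?S = "\<lambda>V. Abs_fps (\<lambda>m. \<Sum>\<mu>\<in>monomials V m. ?p V \<mu>)"
  have cancel: "a * l = p \<Longrightarrow> l * l' = 1 \<Longrightarrow> a = p * l'" for a l l' p :: "complex fps"
    by (metis mult.assoc mult.right_neutral)
  have "?S (insert v V) * (1 - fps_const (c v) * fps_X) = ?S V"
  proof (rule fps_ext)
    fix m
    have "?S (insert v V) * (1 - fps_const (c v) * fps_X) =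
        ?S (insert v V) - fps_const (c v) * (?S (insert v V) * fps_X)"
      by (simp add: algebra_simps)
    then have *: "fps_nth (?S (insert v V) * (1 - fps_const (c v) * fps_X)) m =
        fps_nth (?S (insert v V)) m - c v * fps_nth (?S (insert v V) * fps_X) m"
      by (simp only: fps_sub_nth fps_mult_left_const_nth)
    show "fps_nth (?S (insert v V) * (1 - fps_const (c v) * fps_X)) m = fps_nth (?S V) m"
    proof (cases m)
      case 0
      then show ?thesis unfolding * by (simp add: monomials_0)
    next
      case (Suc n)
      have 1: "?p (insert v V) \<mu> = ?p V \<mu>" if "\<mu> \<in> monomials V (Suc n)" for \<mu>
      proof -
        have "lookup \<mu> v = 0"
          using that insert.hyps by (auto simp: monomials_def in_keys_iff)
        then show ?thesis using insert.hyps by simp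
      qed
      have 2: "?p (insert v V) (single v 1 + \<mu>) = c v * ?p (insert v V) \<mu>" for \<mu>
      proof -
        have "?p V (single v 1 + \<mu>) = ?p V \<mu>"
          using insert.hyps by (intro prod.cong) (auto simp: lookup_add lookup_single when_def)
        then show ?thesis using insert.hyps by (simp add: lookup_add)
      qed
      have "(\<Sum>\<mu>\<in>monomials (insert v V) (Suc n). ?p (insert v V) \<mu>) =
          (\<Sum>\<mu>\<in>monomials V (Suc n). ?p (insert v V) \<mu>) +
          (\<Sum>\<mu>\<in>(\<lambda>\<mu>. single v 1 + \<mu>) ` monomials (insert v V) n. ?p (insert v V) \<mu>)"
        using insert.hyps monomials_insert[of v V n]
        by (simp add: sum.union_disjoint finite_monomials)
      also have "\<dots> = (\<Sum>\<mu>\<in>monomials V (Suc n). ?p V \<mu>) +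
          c v * (\<Sum>\<mu>\<in>monomials (insert v V) n. ?p (insert v V) \<mu>)"
        by (subst sum.reindex) (auto simp: inj_on_def 1 2[simplified] sum_distrib_left simp del: prod.insert intro!: sum.cong)
      finally show ?thesis
        unfolding * by (simp add: Suc)
    qed
  qed
  moreover have "(1 - fps_const (c v) * fps_X) * inverse (1 - fps_const (c v) * fps_X) = 1"
    by (simp add: inverse_mult_eq_1')
  ultimately have "?S (insert v V) = ?S V * inverse (1 - fps_const (c v) * fps_X)"
    by (rule cancel)
  moreover have "(\<Prod>v\<in>insert v V. inverse (1 - fps_const (c v) * fps_X)) =
      ?S V * inverse (1 - fps_const (c v) * fps_X)"
    unfolding prod.insert[OF insert.hyps] insert.IH by (rule mult.commute)
  ultimately show ?case
    by (rule trans[OF _ sym, rotated])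
qed

text \<open>The exponent is \<open>d*\<close> minus the weight rather than \<open>d*\<close> plus the weight: reversing the order of the
  factors of \<open>f_gen\<close> replaces the symmetry \<open>N(m, w) = N(m, -w)\<close>.\<close>

definition hexp :: "nat list \<Rightarrow> var \<Rightarrow> nat" where
  "hexp d = (\<lambda>(k, j). dmax d + 2 * j - d ! k)"

lemma nth_le_dmax: "k < length d \<Longrightarrow> d ! k \<le> dmax d"
  by simp

lemma f_gen_eq:
  assumes "z \<noteq> 0"
  shows "f_gen d (t * z ^ dmax d) z = (\<Prod>x\<in>vars d. 1 / (1 - z ^ hexp d x * t))"
proof -
  have "f_gen d (t * z ^ dmax d) z =
      (\<Prod>k<length d. \<Prod>j\<le>d ! k. 1 / (1 - t * z ^ dmax d * z powi (int (d ! k) - 2 * int (d ! k - j))))"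
    unfolding f_gen_def
  proof (rule prod.cong[OF refl])
    fix k
    show "(\<Prod>j\<le>d ! k. 1 / (1 - t * z ^ dmax d * z powi (int (d ! k) - 2 * int j))) =
        (\<Prod>j\<le>d ! k. 1 / (1 - t * z ^ dmax d * z powi (int (d ! k) - 2 * int (d ! k - j))))"
      by (rule prod.reindex_bij_witness[of _ "\<lambda>j. d ! k - j" "\<lambda>j. d ! k - j"]) auto
  qed
  also have "\<dots> = (\<Prod>k<length d. \<Prod>j\<le>d ! k. 1 / (1 - z ^ hexp d (k, j) * t))"
  proof (intro prod.cong refl)
    fix k j assume kj: "k \<in> {..<length d}" "j \<in> {..d ! k}"
    then have "int (hexp d (k, j)) = int (dmax d) + (int (d ! k) - 2 * int (d ! k - j))"
      using nth_le_dmax[of k d] unfolding hexp_def prod.case lessThan_iff atMost_iff by linarith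
    then have "z ^ hexp d (k, j) = z ^ dmax d * z powi (int (d ! k) - 2 * int (d ! k - j))"
      using assms by (metis power_int_add power_int_of_nat)
    then show "1 / (1 - t * z ^ dmax d * z powi (int (d ! k) - 2 * int (d ! k - j))) =
        1 / (1 - z ^ hexp d (k, j) * t)"
      by (simp add: mult_ac)
  qed
  also have "\<dots> = (\<Prod>x\<in>vars d. 1 / (1 - z ^ hexp d x * t))"
    unfolding vars_def by (subst prod.Sigma) (auto simp: case_prod_beta)
  finally show ?thesis .
qed

definition mexp :: "nat list \<Rightarrow> (var \<Rightarrow>\<^sub>0 nat) \<Rightarrow> nat" where
  "mexp d \<mu> = (\<Sum>x\<in>vars d. hexp d x * lookup \<mu> x)"

text \<open>\<open>hexp d x\<close> is \<open>dmax d\<close> minus the weight of \<open>x\<close>,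
  and \<open>dmax d\<close> is counted once for each of the \<open>m\<close> factors.\<close>

lemma mexp_eq:
  assumes "\<mu> \<in> monomials (vars d) m"
  shows "int (mexp d \<mu>) = int (dmax d * m) - wt d \<mu>"
proof -
  have "m = (\<Sum>x\<in>vars d. lookup \<mu> x)"
    using assms total_deg_superset[OF finite_vars] by (auto simp: monomials_def)
  then have "int (dmax d * m) - wt d \<mu> =
     (\<Sum>x\<in>vars d. int (dmax d) * int (lookup \<mu> x) - (case x of (k, i) \<Rightarrow> (int (d ! k) - 2 * int i) * int (lookup \<mu> (k, i))))"
    by (simp add: sum_subtractf wt_def flip: sum_distrib_left)
  also have "\<dots> = int (mexp d \<mu>)"
    unfolding mexp_def of_nat_sum
  proof (intro sum.cong refl)
    fix x assume "x \<in> vars d"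
    then obtain k i where x: "x = (k, i)" "k < length d" by (auto simp: vars_def)
    have "int (hexp d x) = int (dmax d) - (int (d ! k) - 2 * int i)"
      using nth_le_dmax[OF x(2)] unfolding hexp_def x(1) prod.case by linarith
    then show "int (dmax d) * int (lookup \<mu> x) - (case x of (k, i) \<Rightarrow> (int (d ! k) - 2 * int i) * int (lookup \<mu> (k, i))) =
        int (hexp d x * lookup \<mu> x)"
      by (simp add: x left_diff_distrib)
  qed
  finally show ?thesis ..
qed

text \<open>Both sides are the coefficient of \<open>t^m\<close> in
  \<open>f_gen d (t * z ^ dmax d) z\<close> for fixed \<open>z\<close>: first from the product over
  the variables, then from the negative binomial series of the partial fractions.\<close>

lemma monomial_sum_eq:
  assumes \<beta>: "is_beta d \<beta>" "d \<noteq> []" and z: "z \<noteq> 0" "norm z < 1"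
  shows "(\<Sum>\<mu>\<in>monomials (vars d) m. z ^ mexp d \<mu>) =
    (\<Sum>i\<le>2 * dmax d. \<Sum>k=1..\<beta> i. of_nat ((k + m - 1) choose m) *
      (pf_coeff (2 * dmax d) \<beta> i k z * z ^ (i * m)))"
proof -
  let ?N = "2 * dmax d"
  have exp: "(\<lambda>t. 1 / (1 - c * t)) has_fps_expansion inverse (1 - fps_const c * fps_X)" for c :: complex
    using has_fps_expansion_linear_inverse[of 1 "- c"] by (simp flip: fps_const_neg)
  have 1: "(\<lambda>t. \<Prod>x\<in>vars d. 1 / (1 - z ^ hexp d x * t)) has_fps_expansion
      (\<Prod>x\<in>vars d. inverse (1 - fps_const (z ^ hexp d x) * fps_X))"
    by (intro has_fps_expansion_prod exp)
  have 2: "(\<lambda>t. \<Sum>i\<le>?N. \<Sum>k=1..\<beta> i. pf_coeff ?N \<beta> i k z * (1 / (1 - z ^ i * t)) ^ k) has_fps_expansion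
      (\<Sum>i\<le>?N. \<Sum>k=1..\<beta> i. fps_const (pf_coeff ?N \<beta> i k z) * inverse (1 - fps_const (z ^ i) * fps_X) ^ k)"
    by (intro has_fps_expansion_sum has_fps_expansion_cmult_left has_fps_expansion_power exp)
  have "\<forall>\<^sub>F t in at 0. t \<in> ball 0 1 - {0 :: complex}"
    by (intro eventually_at_in_open) auto
  then have "\<forall>\<^sub>F t in at 0. (\<Prod>x\<in>vars d. 1 / (1 - z ^ hexp d x * t)) =
      (\<Sum>i\<le>?N. \<Sum>k=1..\<beta> i. pf_coeff ?N \<beta> i k z * (1 / (1 - z ^ i * t)) ^ k)"
  proof eventually_elim
    case (elim t)
    \<comment> \<open>No pole lies in the unit disc, as \<open>|z^i t| <= |t| < 1\<close>.\<close>
    have "\<forall>i\<le>?N. z ^ i * t \<noteq> 1"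
    proof (intro allI impI notI)
      fix i assume "z ^ i * t = 1"
      then have "norm z ^ i * norm t = 1"
        by (metis norm_mult norm_one norm_power)
      moreover have "norm z ^ i * norm t \<le> 1 * norm t"
        using z by (intro mult_right_mono power_le_one) auto
      ultimately show False using elim by simp
    qed
    then have "(\<Prod>i\<le>?N. (1 / (1 - z ^ i * t)) ^ \<beta> i) =
       (\<Sum>i\<le>?N. \<Sum>k=1..\<beta> i. pf_coeff ?N \<beta> i k z * (1 / (1 - z ^ i * t)) ^ k)"
      using is_beta_0_pos[OF \<beta>] by (intro partial_fractions_powers z)
    moreover have "f_gen d (t * z ^ dmax d) z = (\<Prod>i\<le>?N. (1 / (1 - z ^ i * t)) ^ \<beta> i)"
      using \<beta> z unfolding is_beta_def by (simp add: mult.commute)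
    ultimately show ?case
      using f_gen_eq[OF z(1), of d t] by simp
  qed
  then have "Abs_fps (\<lambda>m. \<Sum>\<mu>\<in>monomials (vars d) m. \<Prod>x\<in>vars d. (z ^ hexp d x) ^ lookup \<mu> x) =
      (\<Sum>i\<le>?N. \<Sum>k=1..\<beta> i. fps_const (pf_coeff ?N \<beta> i k z) * inverse (1 - fps_const (z ^ i) * fps_X) ^ k)"
    using has_fps_expansion_unique_punctured[OF 1 2] complete_homogeneous_series[OF finite_vars] by metis
  then have "(\<Sum>\<mu>\<in>monomials (vars d) m. \<Prod>x\<in>vars d. (z ^ hexp d x) ^ lookup \<mu> x) =
      fps_nth (\<Sum>i\<le>?N. \<Sum>k=1..\<beta> i. fps_const (pf_coeff ?N \<beta> i k z) * inverse (1 - fps_const (z ^ i) * fps_X) ^ k) m"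
    by (metis fps_nth_Abs_fps)
  also have "\<dots> = (\<Sum>i\<le>2 * dmax d. \<Sum>k=1..\<beta> i. of_nat ((k + m - 1) choose m) *
      (pf_coeff (2 * dmax d) \<beta> i k z * z ^ (i * m)))"
    unfolding fps_sum_nth
  proof (intro sum.cong refl)
    fix i k assume "k \<in> {1..\<beta> i}"
    then have "inverse (1 - fps_const (z ^ i) * fps_X) ^ k = Abs_fps (\<lambda>m. of_nat ((k + m - 1) choose m) * (z ^ i) ^ m)"
      by (simp add: fps_inverse_power[symmetric] one_minus_const_fps_X_neg_power' del: fps_const_power)
    then show "fps_nth (fps_const (pf_coeff ?N \<beta> i k z) * inverse (1 - fps_const (z ^ i) * fps_X) ^ k) m =
       of_nat ((k + m - 1) choose m) * (pf_coeff (2 * dmax d) \<beta> i k z * z ^ (i * m))"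
      by (simp add: power_mult)
  qed
  finally show ?thesis
    unfolding mexp_def by (simp add: power_sum power_mult)
qed

text \<open>Passage from values at \<open>z\<close> to formal series: the identity on the punctured
  disc determines the expansions at 0.\<close>

lemma monomial_sum_fps:
  assumes \<beta>: "is_beta d \<beta>" "d \<noteq> []"
  shows "(\<Sum>\<mu>\<in>monomials (vars d) m. fps_X ^ mexp d \<mu>) =
    (\<Sum>i\<le>2 * dmax d. \<Sum>k=1..\<beta> i. fps_const (of_nat ((k + m - 1) choose m)) *
      (A_fps d \<beta> i k * fps_X ^ (i * m)))"
proof (rule has_fps_expansion_unique_punctured)
  show "(\<lambda>z. \<Sum>\<mu>\<in>monomials (vars d) m. z ^ mexp d \<mu>) has_fps_expansion (\<Sum>\<mu>\<in>monomials (vars d) m. fps_X ^ mexp d \<mu>)"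
    by (intro fps_expansion_intros)
  show "(\<lambda>z. \<Sum>i\<le>2 * dmax d. \<Sum>k=1..\<beta> i. of_nat ((k + m - 1) choose m) *
      (pf_coeff (2 * dmax d) \<beta> i k z * z ^ (i * m))) has_fps_expansion
     (\<Sum>i\<le>2 * dmax d. \<Sum>k=1..\<beta> i. fps_const (of_nat ((k + m - 1) choose m)) *
      (A_fps d \<beta> i k * fps_X ^ (i * m)))"
    using \<beta> by (intro fps_expansion_intros A_fps_expansion) auto
  have "\<forall>\<^sub>F z in at 0. z \<in> ball 0 1 - {0 :: complex}"
    by (intro eventually_at_in_open) auto
  then show "\<forall>\<^sub>F z in at 0. (\<Sum>\<mu>\<in>monomials (vars d) m. z ^ mexp d \<mu>) =
      (\<Sum>i\<le>2 * dmax d. \<Sum>k=1..\<beta> i. of_nat ((k + m - 1) choose m) *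
      (pf_coeff (2 * dmax d) \<beta> i k z * z ^ (i * m)))"
    by (rule eventually_mono) (rule monomial_sum_eq[OF \<beta>], auto)
qed

section \<open>Higher derivatives and the map \<open>\<phi>\<close>\<close>

lemma fps_nth_higher_deriv:
  "fps_nth ((fps_deriv ^^ n) F) m = fact (m + n) / fact m * fps_nth (F :: 'a::field_char_0 fps) (m + n)"
proof (induction n arbitrary: m)
  case (Suc n)
  have cancel: "c \<noteq> 0 \<Longrightarrow> c * (x / (c * y) * z) = x / y * z" for c x y z :: 'a
    by simp
  have "fps_nth ((fps_deriv ^^ Suc n) F) m = of_nat (Suc m) * (fact (Suc m + n) / fact (Suc m) * fps_nth F (Suc m + n))"
    using Suc[of "Suc m"] by simp
  also have "(fact (Suc m) :: 'a) = of_nat (Suc m) * fact m"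
    by (rule fact_Suc)
  finally show ?case
    by (simp only: cancel[OF of_nat_neq_0] add_Suc_shift)
qed simp

text \<open>The differentiated series has coefficient \<open>fps_nth F (n * m)\<close> at index
  \<open>m + k - 1\<close>; the \<open>k - 1\<close> derivatives and the division by
  \<open>(k - 1)!\<close> supply \<open>(m + k - 1)! / (m! (k - 1)!)\<close>.\<close>

lemma phi_term_nth:
  assumes "k \<ge> 1"
  shows "fps_nth (fps_const (1 / fact (k - 1)) * (fps_deriv ^^ (k - 1)) (fps_X ^ (k - 1) * \<phi> n F)) m =
    of_nat ((k + m - 1) choose m) * fps_nth F (n * m)"
proof -
  have "(of_nat ((k + m - 1) choose m) :: complex) = fact (m + (k - 1)) / (fact m * fact (k - 1))"
    using assms binomial_fact[of m "m + (k - 1)", where 'a=complex] by (simp add: add.commute)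
  then show ?thesis
    by (simp add: fps_nth_higher_deriv fps_X_power_mult_nth \<phi>_def mult.commute)
qed

text \<open>The multiplier \<open>G\<close> is left arbitrary so that \<open>1 - X^2\<close> and
  \<open>1 + X\<close> are treated at once.\<close>

lemma coefficient_formula:
  assumes \<beta>: "is_beta d \<beta>" "d \<noteq> []"
  shows "fps_nth (\<Sum>i=0..dmax d. \<Sum>k=1..\<beta> i. fps_const (1 / fact (k - 1)) *
          (fps_deriv ^^ (k - 1)) (fps_X ^ (k - 1) * \<phi> (dmax d - i) (G * A_fps d \<beta> i k))) m =
    fps_nth (G * (\<Sum>\<mu>\<in>monomials (vars d) m. fps_X ^ mexp d \<mu>)) (dmax d * m)"
proof -
  let ?b = "\<lambda>k. of_nat ((k + m - 1) choose m) :: complex"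
  let ?T = "\<lambda>i. \<Sum>k=1..\<beta> i. ?b k * fps_nth (G * A_fps d \<beta> i k * fps_X ^ (i * m)) (dmax d * m)"
  have "G * (\<Sum>\<mu>\<in>monomials (vars d) m. fps_X ^ mexp d \<mu>) =
     (\<Sum>i\<le>2 * dmax d. \<Sum>k=1..\<beta> i. fps_const (?b k) * (G * A_fps d \<beta> i k * fps_X ^ (i * m)))"
    unfolding monomial_sum_fps[OF \<beta>] sum_distrib_left by (simp only: mult_ac)
  then have "fps_nth (G * (\<Sum>\<mu>\<in>monomials (vars d) m. fps_X ^ mexp d \<mu>)) (dmax d * m) = (\<Sum>i\<le>2 * dmax d. ?T i)"
    by (simp only: fps_sum_nth fps_mult_left_const_nth)
  also have "\<dots> = (\<Sum>i=0..dmax d. ?T i)"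
  proof (rule sum.mono_neutral_right)
    show "\<forall>i\<in>{..2 * dmax d} - {0..dmax d}. ?T i = 0"
    proof (intro ballI sum.neutral)
      fix i k assume i: "i \<in> {..2 * dmax d} - {0..dmax d}" 
      have "fps_nth (G * A_fps d \<beta> i k * fps_X ^ (i * m)) (dmax d * m) = 0"
      proof (cases "m = 0")
        case True
        have "fps_nth (A_fps d \<beta> i k) 0 = pf_coeff (2 * dmax d) \<beta> i k 0"
          using has_fps_expansion_imp_0_eq_fps_nth_0[OF A_fps_expansion[OF \<beta>(1)], of i k] i by simp
        also have "\<dots> = 0"
          using i is_beta_0_pos[OF \<beta>] by (intro pf_coeff_0) auto
        finally show ?thesis using True by simp
      next
        case False
        then have "dmax d * m < i * m" using i by simp
        then show ?thesis by (simp only: fps_X_power_mult_right_nth if_True)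
      qed
      then show "?b k * fps_nth (G * A_fps d \<beta> i k * fps_X ^ (i * m)) (dmax d * m) = 0"
        by simp
    qed
  qed auto
  also have "\<dots> = fps_nth (\<Sum>i=0..dmax d. \<Sum>k=1..\<beta> i. fps_const (1 / fact (k - 1)) *
          (fps_deriv ^^ (k - 1)) (fps_X ^ (k - 1) * \<phi> (dmax d - i) (G * A_fps d \<beta> i k))) m"
    unfolding fps_sum_nth
  proof (intro sum.cong refl)
    fix i k assume i: "i \<in> {0..dmax d}" and k: "k \<in> {1..\<beta> i}"
    \<comment> \<open>Removing \<open>X^(i m)\<close> lowers the index to
      \<open>(dmax d - i) * m\<close>, the one that \<open>\<phi> (dmax d - i)\<close> reads at
      \<open>m\<close>.\<close>
    have "fps_nth (G * A_fps d \<beta> i k * fps_X ^ (i * m)) (dmax d * m) = fps_nth (G * A_fps d \<beta> i k) ((dmax d - i) * m)"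
      using i by (simp only: fps_X_power_mult_right_nth) (auto simp: diff_mult_distrib)
    then show "?b k * fps_nth (G * A_fps d \<beta> i k * fps_X ^ (i * m)) (dmax d * m) =
       fps_nth (fps_const (1 / fact (k - 1)) *
          (fps_deriv ^^ (k - 1)) (fps_X ^ (k - 1) * \<phi> (dmax d - i) (G * A_fps d \<beta> i k))) m"
      using k by (subst phi_term_nth) auto
  qed
  finally show ?thesis ..
qed

text \<open>By \<open>mexp_eq\<close>, the exponent \<open>r + mexp d \<mu>\<close> hits
  \<open>dmax d * m\<close> exactly for monomials of weight \<open>r\<close>.\<close>

lemma monomial_sum_nth:
  "fps_nth (fps_X ^ r * (\<Sum>\<mu>\<in>monomials (vars d) m. fps_X ^ mexp d \<mu>)) (dmax d * m) =
    (of_nat (card (wmonos d m (int r))) :: complex)"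
proof -
  have "fps_nth (fps_X ^ r * (\<Sum>\<mu>\<in>monomials (vars d) m. fps_X ^ mexp d \<mu>)) (dmax d * m) =
     (\<Sum>\<mu>\<in>monomials (vars d) m. if wt d \<mu> = int r then 1 else 0 :: complex)"
    unfolding sum_distrib_left fps_sum_nth power_add[symmetric]
  proof (intro sum.cong refl)
    fix \<mu> assume "\<mu> \<in> monomials (vars d) m"
    from mexp_eq[OF this] have "r + mexp d \<mu> = dmax d * m \<longleftrightarrow> wt d \<mu> = int r"
      by linarith
    then show "fps_nth (fps_X ^ (r + mexp d \<mu>)) (dmax d * m) = (if wt d \<mu> = int r then 1 else 0 :: complex)"
      by auto
  qed
  also have "\<dots> = of_nat (card (wmonos d m (int r)))"
    by (simp add: wmonos_def finite_monomials finite_vars flip: sum.inter_filter)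
  finally show ?thesis .
qed

theorem theorem3p1:
  fixes d :: "nat list" and \<beta> :: "nat \<Rightarrow> nat"
  assumes "d \<noteq> []" and "dmax d \<ge> 1" and "is_beta d \<beta>"
  shows
    "poincare_series (joint_invariants d :: 'k::field_char_0 mpol set) =
       (\<Sum>i=0..dmax d. \<Sum>k=1..\<beta> i. fps_const (1 / fact (k - 1)) *
          (fps_deriv ^^ (k - 1))
            (fps_X ^ (k - 1) * \<phi> (dmax d - i) ((1 - fps_X ^ 2) * A_fps d \<beta> i k))) \<and>
     poincare_series (joint_semi_invariants d :: 'k mpol set) =
       (\<Sum>i=0..dmax d. \<Sum>k=1..\<beta> i. fps_const (1 / fact (k - 1)) *
          (fps_deriv ^^ (k - 1))
            (fps_X ^ (k - 1) * \<phi> (dmax d - i) ((1 + fps_X) * A_fps d \<beta> i k)))"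
proof (intro conjI fps_ext)
  fix m
  let ?M = "\<Sum>\<mu>\<in>monomials (vars d) m. fps_X ^ mexp d \<mu> :: complex fps"
  note formula = coefficient_formula[OF assms(3,1)]
  \<comment> \<open>Over the complex numbers the additive dimension formula can be solved by a
    genuine subtraction.\<close>
  have dim: "of_nat (mpol.dim (joint_invariants d \<inter> homogeneous m :: 'k mpol set)) + of_nat (card (wmonos d m 2)) =
      (of_nat (card (wmonos d m 0)) :: complex)"
    by (metis dim_invariants of_nat_add)
  have nth: "fps_nth ((1 - fps_X ^ 2) * ?M) (dmax d * m) =
      of_nat (card (wmonos d m 0)) - of_nat (card (wmonos d m 2))"
    using monomial_sum_nth[of 0 d m] monomial_sum_nth[of 2 d m]
    by (simp add: left_diff_distrib)
  show "fps_nth (poincare_series (joint_invariants d :: 'k mpol set)) m =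
      fps_nth (\<Sum>i=0..dmax d. \<Sum>k=1..\<beta> i. fps_const (1 / fact (k - 1)) *
          (fps_deriv ^^ (k - 1))
            (fps_X ^ (k - 1) * \<phi> (dmax d - i) ((1 - fps_X ^ 2) * A_fps d \<beta> i k))) m"
    unfolding formula nth poincare_series_def using dim by (simp add: algebra_simps)
  have "fps_nth ((1 + fps_X) * ?M) (dmax d * m) =
      of_nat (card (wmonos d m 0)) + of_nat (card (wmonos d m 1))"
    using monomial_sum_nth[of 0 d m] monomial_sum_nth[of 1 d m]
    by (simp add: distrib_right)
  then show "fps_nth (poincare_series (joint_semi_invariants d :: 'k mpol set)) m =
      fps_nth (\<Sum>i=0..dmax d. \<Sum>k=1..\<beta> i. fps_const (1 / fact (k - 1)) *
          (fps_deriv ^^ (k - 1))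
            (fps_X ^ (k - 1) * \<phi> (dmax d - i) ((1 + fps_X) * A_fps d \<beta> i k))) m"
    unfolding formula poincare_series_def by (simp add: dim_semi_invariants)
qed

end
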